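(* Let $K\subset\mathbb{R}^d$ be a strictly convex polyhedral cone with apex $v$ and set of generators $W=\{w_1,\dots,w_n\}$, $n\ge d$, and let $p_K$ be the homogeneous polynomial of degree $n-d$ attached to $K$ and $W$ (defined in the context). Let $D=\{w_{i_1},\dots,w_{i_{d-1}}\}$ be a diagonal of $K$, i.e. a $(d-1)$-element subset of $W$, and set $D^*:=[w_{i_1},\dots,w_{i_{d-1}}]$ (generalized cross product). (i) If $D$ is extremal, then $$p_K(D^* )=\varepsilon\prod_{\substack{1\le j\le n\\ w_j\notin D}}\det(w_{i_1},\dots,w_{i_{d-1}},w_j),$$ where $\varepsilon\in\{1,-1\}$ is the common sign of all the nonzero determinants appearing on the right-hand side (if one of the determinants is zero, the right-hand side is $0$). (ii) If $D$ is interior, then $p_K(D^* )=0$.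
   Context: $\langle\cdot,\cdot\rangle$ is the standard inner product on $\mathbb{R}^d$. The cone with apex $v$ and generators $w_1,\dots,w_n$ is $K=\{v+t_1w_1+\dots+t_nw_n : t_1,\dots,t_n>0\}$, where the $w_i$ are distinct nonzero vectors; strictly convex means that $K$ does not contain a line (equivalently, there is $\xi$ with $\langle w_i,\xi\rangle>0$ for all $i$). Generalized cross product: for $x_1,\dots,x_{d-1}\in\mathbb{R}^d$, $[x_1,\dots,x_{d-1}]\in\mathbb{R}^d$ is the unique vector with $\langle[x_1,\dots,x_{d-1}],x\rangle=\det(x_1,\dots,x_{d-1},x)$ for all $x\in\mathbb{R}^d$. The polynomial $p_K$: it is the unique homogeneous polynomial in $\xi=(\xi_1,\dots,\xi_d)$ of degree $n-d$ such that $$\int_K e^{-\langle x-v,\xi\rangle}\,dx=\frac{p_K(\xi)}{\prod_{i=1}^n\langle w_i,\xi\rangle}$$ for all $\xi\in\mathbb{R}^d$ with $\langle w_i,\xi\rangle>0$ for every $i$. For example, when $n=d$, $p_K$ is the constant $|\det(w_1,\dots,w_d)|$. Diagonals: a diagonal of $K$ is a $(d-1)$-element subset $D$ of $W$, with a fixed ordering $w_{i_1},\dots,w_{i_{d-1}}$ of its elements. It is extremal if the cone $\{v+\sum_{x\in D}t_x x: t_x>0\}$ spanned by $D$ at the apex is contained in the boundary $\partial K$ of $K$, and interior otherwise. *)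

theory Defs
  imports "HOL-Analysis.Analysis"
begin

text \<open>
  The space is \<open>real ^ 'd\<close>, where the finite index type \<open>'d\<close> carries a linear order that plays
  the role of the order of the coordinates \<open>1, \<dots>, d\<close>. The order is needed to say which column
  of a determinant is the k-th one.
\<close>

definition gen_cone :: "real ^ 'd \<Rightarrow> (real ^ 'd) set \<Rightarrow> (real ^ 'd) set" where
  "gen_cone v W = {v + (\<Sum>w\<in>W. t w *\<^sub>R w) | t. \<forall>w\<in>W. t w > 0}"

definition contains_line :: "'a::real_vector set \<Rightarrow> bool" where
  "contains_line S \<longleftrightarrow> (\<exists>a u. u \<noteq> 0 \<and> (\<forall>t. a + t *\<^sub>R u \<in> S))"

definition strictly_convex_cone :: "'a::real_vector set \<Rightarrow> bool" where
  "strictly_convex_cone K \<longleftrightarrow> \<not> contains_line K"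

text \<open>
  The determinant of the matrix with columns \<open>xs ! 0, xs ! 1, \<dots>\<close>; the column index \<open>j\<close> has rank
  \<open>card {..<j}\<close> in the order of \<open>'d\<close>. Only meaningful if \<open>length xs = CARD('d)\<close>.
\<close>

definition det_cols :: "(real ^ 'd::{finite,linorder}) list \<Rightarrow> real" where
  "det_cols xs = det (\<chi> i j. (xs ! card {..<j}) $ i)"

definition gen_cross :: "(real ^ 'd::{finite,linorder}) list \<Rightarrow> real ^ 'd::{finite,linorder}" where
  "gen_cross xs = (THE c. \<forall>x. c \<bullet> x = det_cols (xs @ [x]))"

text \<open>
  Real polynomials in \<open>\<xi>\<close> are identified with polynomial functions; \<open>\<alpha>\<close> ranges over the
  (finitely many) exponent vectors of total degree \<open>m\<close>. The zero polynomial is homogeneous of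
  every degree.
\<close>

definition homogeneous_poly :: "nat \<Rightarrow> (real ^ 'd \<Rightarrow> real) \<Rightarrow> bool" where
  "homogeneous_poly m p \<longleftrightarrow>
     (\<exists>c :: ('d \<Rightarrow> nat) \<Rightarrow> real.
        \<forall>\<xi>. p \<xi> = (\<Sum>\<alpha> | (\<Sum>i\<in>UNIV. \<alpha> i) = m. c \<alpha> * (\<Prod>i\<in>UNIV. (\<xi> $ i) ^ \<alpha> i)))"

definition cone_poly :: "real ^ 'd \<Rightarrow> (real ^ 'd) set \<Rightarrow> real ^ 'd \<Rightarrow> real" where
  "cone_poly v W = (THE p. homogeneous_poly (card W - CARD('d)) p \<and>
     (\<forall>\<xi>. (\<forall>w\<in>W. w \<bullet> \<xi> > 0) \<longrightarrow>
        (LINT x : gen_cone v W | lborel. exp (- ((x - v) \<bullet> \<xi>))) = p \<xi> / (\<Prod>w\<in>W. w \<bullet> \<xi>)))"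

text \<open>A diagonal is given by the list of its elements in the chosen order.\<close>

definition is_diagonal :: "(real ^ 'd) set \<Rightarrow> (real ^ 'd) list \<Rightarrow> bool" where
  "is_diagonal W D \<longleftrightarrow> distinct D \<and> set D \<subseteq> W \<and> length D = CARD('d) - 1"

definition extremal :: "real ^ 'd \<Rightarrow> (real ^ 'd) set \<Rightarrow> (real ^ 'd) list \<Rightarrow> bool" where
  "extremal v W D \<longleftrightarrow> gen_cone v (set D) \<subseteq> frontier (gen_cone v W)"

definition interior_diagonal :: "real ^ 'd \<Rightarrow> (real ^ 'd) set \<Rightarrow> (real ^ 'd) list \<Rightarrow> bool" where
  "interior_diagonal v W D \<longleftrightarrow> \<not> extremal v W D"

end

theory Submission
  imports Defs
begin

text \<open>
  Idea: choose generic heights \<open>h w\<close> for the generators. The bases \<open>\<sigma> \<subseteq> W\<close> whose linear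
  interpolation of the heights lies strictly below \<open>h\<close> outside \<open>\<sigma>\<close> triangulate the cone, which
  is linear programming duality: the simplex containing a generic \<open>x\<close> is the optimal basis for
  writing \<open>x\<close> as a nonnegative combination of \<open>W\<close> at least cost. Integrating over the simplices,
  \<open>p\<^sub>K(\<xi>) = (\<Sum>\<sigma>. \<bar>det \<sigma>\<bar> * (\<Prod>w\<in>W - \<sigma>. \<langle>w,\<xi>\<rangle>))\<close>.

  At \<open>\<xi> = D\<^sup>*\<close> only the simplices \<open>\<sigma> = D \<union> {w}\<close> survive, so \<open>p\<^sub>K(D\<^sup>*)\<close> is \<open>\<Prod>w\<in>W - D. det(D, w)\<close> times
  the sum of the signs of \<open>det(D, w)\<close> over the simplices that contain \<open>D\<close>. If the product does not
  vanish, that sum is the jump of the indicator function of the cone when a generic point of the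
  relative interior of the cone over \<open>D\<close> is crossed in the direction \<open>D\<^sup>*\<close>: it is \<open>\<plusminus>1\<close> on the
  boundary and \<open>0\<close> in the interior.
\<close>

text \<open>Strict convexity enters as a vector \<xi> that pairs positively with every generator.
  The same \<xi> makes the integrals finite, keeps every pivot of the linear program bounded, and
  shows that the region of convergence is open and nonempty, which pins the polynomial down.

  The open cone is not the union of its open simplices: the walls are missing. The decomposition is
  therefore an identity of indicator functions at the points outside every span of fewer than d
  generators. Integrals do not see the excluded null set, but the jump needs the identity at
  particular points. Hence the base point \<open>q\<close> on the diagonal must avoid all these
  spans except that of D; then \<open>q\<close> shifted by a small multiple of
  \<open>D\<^sup>*\<close> in either direction is generic.

  For d > 1, \<open>D\<^sup>*\<close> is orthogonal to the elements of D, so it lies outside the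
  region of convergence and only the polynomial can be evaluated there. If some det(D, w) vanishes,
  the hyperplane of D is no longer a wall met by D alone, but then the product is zero and both
  claims hold at once. Otherwise D is independent, and extremal or interior means that the remaining
  generators lie on one side or on both sides of its hyperplane.\<close>

section \<open>Linear substitution in integrals over \<open>real ^ 'n\<close>\<close>

text \<open>
  The library proves the linear change of variables only for index types of class \<open>wellorder\<close>,
  which \<open>{finite, linorder}\<close> does not entail for the type system; \<open>'n wo\<close> is a well-ordered copy of
  the finite type \<open>'n\<close>.
\<close>

typedef 'n wo = "UNIV :: 'n set" morphisms of_wo to_wo by simp

instance wo :: (finite) finite
proof
  have "range (to_wo :: 'a \<Rightarrow> 'a wo) = UNIV" by (metis of_wo_inverse surjI)
  thus "finite (UNIV :: 'a wo set)" by (metis finite finite_imageI)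
qed

instantiation wo :: (finite) wellorder
begin

definition less_eq_wo :: "'a wo \<Rightarrow> 'a wo \<Rightarrow> bool" where
  "less_eq_wo x y \<longleftrightarrow> to_nat_on UNIV (of_wo x) \<le> to_nat_on UNIV (of_wo y)"

definition less_wo :: "'a wo \<Rightarrow> 'a wo \<Rightarrow> bool" where
  "less_wo x y \<longleftrightarrow> to_nat_on UNIV (of_wo x) < to_nat_on UNIV (of_wo y)"

instance
proof
  fix x y z :: "'a wo" and P :: "'a wo \<Rightarrow> bool"
  show "x = y" if "x \<le> y" "y \<le> x"
    using that unfolding less_eq_wo_def
    by (metis UNIV_I antisym countable_finite finite inj_on_to_nat_on inj_onD of_wo_inject)
  show "P x" if "\<And>x. (\<And>y. y < x \<Longrightarrow> P y) \<Longrightarrow> P x"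
    by (induction x rule: measure_induct_rule[of "\<lambda>x. to_nat_on UNIV (of_wo x)"])
       (use that less_wo_def in blast)
qed (auto simp: less_eq_wo_def less_wo_def)

end

definition reindex :: "real ^ 'n::finite wo \<Rightarrow> real ^ 'n" where
  "reindex y = (\<chi> i. y $ to_wo i)"

definition unreindex :: "real ^ 'n::finite \<Rightarrow> real ^ 'n wo" where
  "unreindex x = (\<chi> i. x $ of_wo i)"

lemma reindex_unreindex [simp]: "reindex (unreindex x) = x" "unreindex (reindex y) = y"
  by (simp_all add: reindex_def unreindex_def vec_eq_iff to_wo_inverse of_wo_inverse)

lemma linear_reindex: "linear reindex" "linear unreindex"
  by (auto intro!: linearI simp: reindex_def unreindex_def vec_eq_iff)

lemma prod_Basis_vec: "(\<Prod>b\<in>Basis. f b) = (\<Prod>i\<in>UNIV. f (axis i (1::real)))"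
  for f :: "real ^ 'n::finite \<Rightarrow> 'c::comm_monoid_mult"
proof -
  have B: "(Basis :: (real^'n) set) = (\<lambda>i. axis i 1) ` UNIV" by (auto simp: Basis_vec_def)
  have inj: "inj (\<lambda>i::'n. axis i (1::real))" by (auto intro!: injI simp: axis_eq_axis)
  show ?thesis unfolding B prod.reindex[OF inj] by simp
qed

text \<open>Renaming coordinates pulls boxes back to boxes with the same side lengths, and the
  values on boxes determine the measure.\<close>

lemma lborel_reindex: "lborel = distr lborel borel (reindex :: real ^ 'n::finite wo \<Rightarrow> _)"
proof (rule lborel_eqI)
  fix l u :: "real ^ 'n"
  assume le: "\<And>b. b \<in> Basis \<Longrightarrow> l \<bullet> b \<le> u \<bullet> b"
  hence le': "l $ i \<le> u $ i" for i by (metis axis_in_Basis_iff cart_eq_inner_axis Basis_real_def insertI1)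
  have [measurable]: "(reindex :: real ^ 'n wo \<Rightarrow> _) \<in> borel_measurable borel"
    by (intro borel_measurable_continuous_onI linear_continuous_on linear_linear[THEN iffD2] linear_reindex)
  have "reindex -` box l u = box (unreindex l) (unreindex u)"
    by (auto simp: mem_box_cart reindex_def unreindex_def) (metis of_wo_inverse, metis of_wo_inverse, metis to_wo_inverse UNIV_I, metis to_wo_inverse UNIV_I)
  hence "emeasure (distr lborel borel reindex) (box l u) = emeasure lborel (box (unreindex l) (unreindex u))"
    by (simp add: emeasure_distr)
  also have "\<dots> = (\<Prod>i\<in>UNIV. ennreal ((u - l) $ of_wo i))"
    using le' by (subst emeasure_lborel_box, force simp: Basis_vec_def inner_axis unreindex_def)
      (simp add: inner_axis unreindex_def prod_Basis_vec prod_ennreal)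
  also have "\<dots> = (\<Prod>i\<in>UNIV. ennreal ((u - l) $ i))"
    by (rule prod.reindex_bij_witness[of _ to_wo of_wo]) (auto simp: to_wo_inverse of_wo_inverse)
  also have "\<dots> = (\<Prod>b\<in>Basis. (u - l) \<bullet> b)"
    using le' by (simp add: prod_Basis_vec inner_axis prod_ennreal)
  finally show "emeasure (distr lborel borel reindex) (box l u) = (\<Prod>b\<in>Basis. (u - l) \<bullet> b)" .
qed simp

text \<open>Conjugation by the bijection of index types matches the permutations in the two Leibniz
  sums and preserves their signs.\<close>

lemma det_reindex: "det (\<chi> i j. A $ of_wo i $ of_wo j) = det (A :: real ^ 'n::finite ^ 'n)"
proof -
  have inj: "inj (to_wo :: 'n \<Rightarrow> _)" "inj (of_wo :: 'n wo \<Rightarrow> _)"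
    by (auto intro!: injI simp: to_wo_inject of_wo_inject)
  have bij: "bij (to_wo :: 'n \<Rightarrow> _)" "bij (of_wo :: 'n wo \<Rightarrow> _)"
    by (metis bijI' of_wo_inverse to_wo_inverse UNIV_I)+
  show ?thesis
    unfolding det_def
  proof (rule sum.reindex_bij_witness[of _ "map_permutation UNIV to_wo" "map_permutation UNIV of_wo"])
    fix p :: "'n wo \<Rightarrow> 'n wo" assume "p \<in> {p. p permutes UNIV}"
    hence p: "p permutes UNIV" by simp
    show "map_permutation UNIV to_wo (map_permutation UNIV of_wo p) = p"
      using bij(2) p by (rule map_permutation_compose_inv) (simp add: of_wo_inverse)
    show "map_permutation UNIV of_wo p \<in> {p. p permutes UNIV}"
      using map_permutation_permutes[OF bij(2) p] by simp
    have "(\<Prod>i\<in>UNIV. A $ i $ map_permutation UNIV of_wo p i) = (\<Prod>i\<in>UNIV. A $ of_wo i $ of_wo (p i))"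
      by (rule prod.reindex_bij_witness[of _ of_wo to_wo])
         (auto simp: to_wo_inverse of_wo_inverse map_permutation_apply[OF inj(2), symmetric])
    thus "of_int (sign (map_permutation UNIV of_wo p)) * (\<Prod>i\<in>UNIV. A $ i $ map_permutation UNIV of_wo p i) =
        of_int (sign p) * (\<Prod>i\<in>UNIV. (\<chi> i j. A $ of_wo i $ of_wo j) $ i $ p i)"
      using evenperm_map_permutation[OF inj(2) p] by (simp add: sign_def)
  next
    fix p :: "'n \<Rightarrow> 'n" assume "p \<in> {p. p permutes UNIV}"
    hence p: "p permutes UNIV" by simp
    show "map_permutation UNIV of_wo (map_permutation UNIV to_wo p) = p"
      using bij(1) p by (rule map_permutation_compose_inv) (simp add: to_wo_inverse)
    show "map_permutation UNIV to_wo p \<in> {p. p permutes UNIV}"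
      using map_permutation_permutes[OF bij(1) p] by simp
  qed
qed

lemma lborel_linear_image_wellorder:
  fixes f :: "real ^ 'n::{finite,wellorder} \<Rightarrow> real ^ 'n::_"
  assumes "linear f" "det (matrix f) \<noteq> 0"
  shows "lborel = density (distr lborel borel f) (\<lambda>_. ennreal \<bar>det (matrix f)\<bar>)"
proof (rule lborel_eqI)
  have inj: "inj f" using det_nz_iff_inj assms by blast
  obtain g where g: "linear g" "\<And>x. g (f x) = x" "\<And>x. f (g x) = x"
    using linear_injective_isomorphism[OF assms(1) inj] by auto
  have fm [measurable]: "f \<in> borel_measurable borel"
    using assms(1) by (intro borel_measurable_continuous_onI linear_continuous_on linear_linear[THEN iffD2])
  fix l u :: "real ^ 'n::_"
  assume le: "\<And>b. b \<in> Basis \<Longrightarrow> l \<bullet> b \<le> u \<bullet> b"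
  have vi: "f -` box l u = g ` box l u"
    using g by (auto simp: image_iff) metis
  have meas: "g ` box l u \<in> lmeasurable" using g(1) by (intro measurable_linear_image) auto
  \<comment> \<open>Writing the box as the \<open>f\<close>-image of its preimage turns the volume
    formula for images into one for preimages.\<close>
  have "f ` g ` box l u = box l u" using g by (auto simp: image_image)
  hence "measure lebesgue (box l u) = \<bar>det (matrix f)\<bar> * measure lebesgue (g ` box l u)"
    using measure_linear_image[OF assms(1) meas] by simp
  moreover have "emeasure lborel (f -` box l u) = ennreal (measure lebesgue (g ` box l u))"
  proof -
    have "f -` box l u \<in> sets borel" using measurable_sets_borel[OF fm] by simp
    hence "emeasure lborel (f -` box l u) = emeasure lebesgue (f -` box l u)" by simp
    thus ?thesis using meas vi by (simp add: emeasure_eq_measure2)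
  qed
  ultimately have "emeasure (density (distr lborel borel f) (\<lambda>_. ennreal \<bar>det (matrix f)\<bar>)) (box l u)
      = ennreal (measure lebesgue (box l u))"
    by (simp add: emeasure_density emeasure_distr nn_integral_cmult ennreal_mult')
  thus "emeasure (density (distr lborel borel f) (\<lambda>_. ennreal \<bar>det (matrix f)\<bar>)) (box l u) = (\<Prod>b\<in>Basis. (u - l) \<bullet> b)"
    using le by (simp add: measure_completion)
qed simp

text \<open>Conjugating \<open>f\<close> by \<open>reindex\<close> reduces the claim to the
  well-ordered copy, and \<open>det_reindex\<close> shows that the determinant survives.\<close>

theorem nn_integral_linear_substitution:
  fixes f :: "real ^ 'n::finite \<Rightarrow> real ^ 'n" and g :: "real ^ 'n \<Rightarrow> ennreal"
  assumes f: "linear f" "det (matrix f) \<noteq> 0" and g [measurable]: "g \<in> borel_measurable borel"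
  shows "(\<integral>\<^sup>+x. g x \<partial>lborel) = ennreal \<bar>det (matrix f)\<bar> * (\<integral>\<^sup>+x. g (f x) \<partial>lborel)"
proof -
  let ?f = "unreindex \<circ> f \<circ> reindex"
  have lin: "linear ?f" using f(1) linear_reindex by (intro linear_compose)
  have "matrix ?f = (\<chi> i j. matrix f $ of_wo i $ of_wo j)"
  proof -
    have "reindex (axis j 1) = axis (of_wo j) (1::real)" for j :: "'n wo"
      by (auto simp: reindex_def axis_def vec_eq_iff to_wo_inverse of_wo_inverse)
    note * = this
    show ?thesis by (simp add: matrix_def unreindex_def *)
  qed
  hence det: "det (matrix ?f) = det (matrix f)" by (simp add: det_reindex)
  have m1 [measurable]: "(reindex :: real ^ 'n wo \<Rightarrow> _) \<in> borel_measurable borel"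
    "(unreindex :: real ^ 'n \<Rightarrow> _) \<in> borel_measurable borel" "f \<in> borel_measurable borel"
    by (intro borel_measurable_continuous_onI linear_continuous_on linear_linear[THEN iffD2] linear_reindex f)+
  have "(\<integral>\<^sup>+x. g x \<partial>lborel) = (\<integral>\<^sup>+y. g (reindex y) \<partial>lborel)"
    by (subst lborel_reindex) (simp add: nn_integral_distr)
  also have "\<dots> = (\<integral>\<^sup>+y. ennreal \<bar>det (matrix f)\<bar> * g (reindex (?f y)) \<partial>lborel)"
    using det f(2)
    by (subst lborel_linear_image_wellorder[OF lin]) (simp_all add: nn_integral_density nn_integral_distr)
  also have "\<dots> = ennreal \<bar>det (matrix f)\<bar> * (\<integral>\<^sup>+y. g (f (reindex y)) \<partial>lborel)"
    by (simp add: nn_integral_cmult)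
  also have "(\<integral>\<^sup>+y. g (f (reindex y)) \<partial>lborel) = (\<integral>\<^sup>+x. g (f x) \<partial>lborel)"
    by (subst (2) lborel_reindex) (simp add: nn_integral_distr)
  finally show ?thesis .
qed

section \<open>Exponential integrals over simplicial cones\<close>

lemma nn_integral_exp_halfline:
  assumes "0 < (a::real)"
  shows "(\<integral>\<^sup>+t. ennreal (exp (- (a * t)) * indicator {0<..} t) \<partial>lborel) = ennreal (1 / a)"
proof -
  have "(\<integral>\<^sup>+t. ennreal (exp (- (a * t)) * indicator {0<..} t) \<partial>lborel)
      = (\<integral>\<^sup>+t. ennreal (exp (- (a * t))) * indicator {0..} t \<partial>lborel)"
    \<comment> \<open>The open and the closed half-line differ by one null point.\<close>
    by (intro nn_integral_cong_AE, rule AE_mp[OF AE_lborel_singleton[of 0]]) (auto split: split_indicator)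
  also have "\<dots> = ennreal (0 - (- exp (- (a * 0)) / a))"
  proof (rule nn_integral_FTC_atLeast)
    show "((\<lambda>t. - exp (- (a * t)) / a) \<longlongrightarrow> 0) at_top"
    proof -
      have "filterlim (\<lambda>t. - (a * t)) at_bot at_top"
        using assms
        by (intro filterlim_compose[OF filterlim_uminus_at_bot_at_top]
            filterlim_tendsto_pos_mult_at_top[OF tendsto_const _ filterlim_ident])
      from tendsto_mult_left[OF filterlim_compose[OF exp_at_bot this], of "- 1 / a"]
      show ?thesis by simp
    qed
  qed (use assms in \<open>auto intro!: derivative_eq_intros\<close>)
  finally show ?thesis by simp
qed

lemma nn_integral_exp_orthant:
  fixes a :: "'n::finite \<Rightarrow> real"
  assumes "\<And>i. 0 < a i"
  shows "(\<integral>\<^sup>+y. ennreal (exp (- (\<Sum>i\<in>UNIV. a i * y $ i)) * indicator {y. \<forall>i. 0 < y $ i} y)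
           \<partial>(lborel :: (real ^ 'n) measure)) = ennreal (1 / (\<Prod>i\<in>UNIV. a i))"
proof -
  \<comment> \<open>\<open>b\<close> moves the coefficients from indices to basis vectors, since the
    product formula for integrals runs over \<open>Basis\<close>.\<close>
  define b where "b = (\<lambda>v::real^'n. \<Sum>i\<in>UNIV. a i * v $ i)"
  have b: "b (axis i 1) = a i" for i
    by (simp add: b_def axis_def if_distrib cong: if_cong)
  have "exp (- (\<Sum>i\<in>UNIV. a i * y $ i)) * indicator {y. \<forall>i. 0 < y $ i} y
      = (\<Prod>v\<in>Basis. exp (- (b v * (y \<bullet> v))) * indicator {0<..} (y \<bullet> v))" for y :: "real ^ 'n"
  proof -
    have "(\<Prod>v\<in>Basis. exp (- (b v * (y \<bullet> v))) * indicator {0<..} (y \<bullet> v)) =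
       (\<Prod>i\<in>UNIV. exp (- (a i * y $ i))) * (\<Prod>i\<in>UNIV. indicator {0<..} (y $ i))"
      by (simp add: prod_Basis_vec b inner_axis prod.distrib)
    also have "(\<Prod>i\<in>UNIV. exp (- (a i * y $ i))) = exp (- (\<Sum>i\<in>UNIV. a i * y $ i))"
      by (simp add: exp_sum sum_negf[symmetric])
    also have "(\<Prod>i\<in>UNIV. indicator {0<..} (y $ i)) = (indicator {y. \<forall>i. 0 < y $ i} y :: real)"
      by (auto simp: indicator_def prod_zero_iff split: if_splits)
    finally show ?thesis by simp
  qed
  hence "(\<integral>\<^sup>+y. ennreal (exp (- (\<Sum>i\<in>UNIV. a i * y $ i)) * indicator {y. \<forall>i. 0 < y $ i} y)
           \<partial>(lborel :: (real ^ 'n) measure))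
      = (\<integral>\<^sup>+y. (\<Prod>v\<in>Basis. ennreal (exp (- (b v * (y \<bullet> v))) * indicator {0<..} (y \<bullet> v))) \<partial>lborel)"
    by (simp add: prod_ennreal)
  also have "\<dots> = (\<Prod>v\<in>Basis. \<integral>\<^sup>+t. ennreal (exp (- (b v * t)) * indicator {0<..} t) \<partial>lborel)"
    by (rule nn_integral_lborel_prod) auto
  also have "\<dots> = (\<Prod>i\<in>UNIV. ennreal (1 / a i))"
    using assms by (simp add: prod_Basis_vec b nn_integral_exp_halfline)
  also have "\<dots> = ennreal (1 / (\<Prod>i\<in>UNIV. a i))"
    using assms by (simp add: prod_ennreal prod_dividef less_imp_le)
  finally show ?thesis .
qed

section \<open>Determinants, and simplicial cones as linear images of the orthant\<close>

definition col_rank :: "'d::{finite,linorder} \<Rightarrow> nat" where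
  "col_rank j = card {..<j}"

lemma bij_col_rank: "bij_betw col_rank (UNIV :: 'd::{finite,linorder} set) {..<CARD('d)}"
proof -
  have mono: "col_rank i < col_rank j" if "i < j" for i j :: 'd
    unfolding col_rank_def using that by (intro psubset_card_mono) auto
  hence inj: "inj (col_rank :: 'd \<Rightarrow> nat)"
    by (metis injI less_irrefl linorder_neqE)
  have "range (col_rank :: 'd \<Rightarrow> nat) \<subseteq> {..<CARD('d)}"
    by (auto simp: col_rank_def intro!: psubset_card_mono)
  moreover have "card (range (col_rank :: 'd \<Rightarrow> nat)) = CARD('d)"
    using inj by (simp add: card_image)
  ultimately have "range (col_rank :: 'd \<Rightarrow> nat) = {..<CARD('d)}"
    by (intro card_subset_eq) auto
  with inj show ?thesis by (simp add: bij_betw_def)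
qed

lemma bij_nth_col_rank:
  assumes "distinct xs" "length xs = CARD('d::{finite,linorder})"
  shows "bij_betw (\<lambda>j::'d. xs ! col_rank j) UNIV (set xs)"
proof -
  have "bij_betw ((!) xs) {..<CARD('d)} (set xs)" using bij_betw_nth[OF assms(1)] assms(2) by simp
  from bij_betw_trans[OF bij_col_rank this] show ?thesis by (simp add: o_def)
qed

text \<open>The linear map whose matrix has the columns \<open>xs\<close>; for distinct entries it
  carries the open orthant onto the cone over \<open>set xs\<close>.\<close>

definition col_map :: "(real ^ 'd::{finite,linorder}) list \<Rightarrow> real ^ 'd::_ \<Rightarrow> real ^ 'd::{finite,linorder}" where
  "col_map xs y = (\<Sum>j\<in>UNIV. y $ j *\<^sub>R (xs ! col_rank j))"

lemma linear_col_map: "linear (col_map xs)"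
  by (rule linearI) (simp_all add: col_map_def scaleR_left_distrib sum.distrib scaleR_sum_right)

lemma det_col_map: "det (matrix (col_map xs)) = det_cols xs"
proof -
  have "matrix (col_map xs) = (\<chi> i j. (xs ! card {..<j}) $ i)"
    by (simp add: matrix_def col_map_def axis_def col_rank_def vec_eq_iff if_distrib[of "\<lambda>c. c *\<^sub>R _"] cong: if_cong)
  thus ?thesis by (simp add: det_cols_def)
qed

text \<open>A kernel vector of \<open>col_map\<close> is a linear relation between the columns.
  Conversely, an injective \<open>col_map\<close> is onto, and \<open>CARD('d)\<close> spanning
  vectors leave no room for repetition or dependence.\<close>

lemma det_cols_nz_iff:
  fixes xs :: "(real ^ 'd::{finite,linorder}) list"
  assumes "length xs = CARD('d)"
  shows "det_cols xs \<noteq> 0 \<longleftrightarrow> distinct xs \<and> independent (set xs)"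
proof
  assume "distinct xs \<and> independent (set xs)"
  hence xs: "distinct xs" "independent (set xs)" by auto
  note bij = bij_nth_col_rank[OF xs(1) assms]
  have "inj (col_map xs)"
  proof (rule linear_injective_0[OF linear_col_map, THEN iffD2], safe)
    fix y assume y: "col_map xs y = 0"
    define u where "u = (\<lambda>x. y $ the_inv_into UNIV (\<lambda>j. xs ! col_rank j) x)"
    have u: "u (xs ! col_rank j) = y $ j" for j
      using the_inv_f_f[OF bij_betw_imp_inj_on[OF bij], of j] by (simp add: u_def)
    have "(\<Sum>x\<in>set xs. u x *\<^sub>R x) = col_map xs y"
      unfolding col_map_def sum.reindex_bij_betw[OF bij, symmetric] u ..
    with y have "(\<Sum>x\<in>set xs. u x *\<^sub>R x) = 0" by simp
    hence "\<forall>x\<in>set xs. u x = 0"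
      using xs(2) unfolding dependent_finite[OF finite_set] by blast
    hence "y $ j = 0" for j using bij u by (metis UNIV_I bij_betwE)
    thus "y = 0" by (simp add: vec_eq_iff)
  qed
  thus "det_cols xs \<noteq> 0"
    using det_nz_iff_inj[OF linear_col_map] det_col_map by metis
next
  assume "det_cols xs \<noteq> 0"
  hence inj: "inj (col_map xs)" using det_nz_iff_inj[OF linear_col_map] det_col_map by metis
  have "surj (col_map xs)" using inj linear_col_map linear_injective_imp_surjective by blast
  moreover have "range (col_map xs) \<subseteq> span (set xs)"
  proof -
    have "xs ! col_rank (j::'d) \<in> set xs" for j
      using bij_betwE[OF bij_col_rank] assms by (metis UNIV_I lessThan_iff nth_mem)
    hence "col_map xs y \<in> span (set xs)" for y
      unfolding col_map_def by (intro span_sum span_scale span_base)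
    thus ?thesis by auto
  qed
  ultimately have "UNIV = span (set xs)" by auto
  hence *: "CARD('d) \<le> card (set xs)" and sp: "UNIV \<subseteq> span (set xs)"
    using real_vector.dim_le_card[of "UNIV :: (real ^ 'd::_) set" "set xs"] by auto
  hence "distinct xs" using assms card_length[of xs] by (intro card_distinct) simp
  moreover have "independent (set xs)"
    using sp * card_length[of xs] assms
    by (intro card_le_dim_spanning[of _ "UNIV :: (real ^ 'd::_) set"]) auto
  ultimately show "distinct xs \<and> independent (set xs)" by blast
qed

lemma gen_cone_col_map:
  fixes xs :: "(real ^ 'd::{finite,linorder}) list"
  assumes "distinct xs" "length xs = CARD('d)"
  shows "gen_cone 0 (set xs) = col_map xs ` {y. \<forall>i. 0 < y $ i}"
proof -
  note bij = bij_nth_col_rank[OF assms]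
  have 1: "(\<Sum>w\<in>set xs. t w *\<^sub>R w) = col_map xs (\<chi> j. t (xs ! col_rank j))" for t
    unfolding col_map_def sum.reindex_bij_betw[OF bij, symmetric] by simp
  have pos: "0 < t (xs ! col_rank j)" if "\<forall>w\<in>set xs. 0 < t w" for t :: "_ \<Rightarrow> real" and j :: 'd
    using that bij by (metis UNIV_I bij_betwE)
  have "col_map xs y \<in> gen_cone 0 (set xs)" if "\<forall>i. 0 < y $ i" for y
  proof -
    define t where "t = (\<lambda>x. y $ the_inv_into UNIV (\<lambda>j. xs ! col_rank j) x)"
    have t: "t (xs ! col_rank j) = y $ j" for j
      using the_inv_f_f[OF bij_betw_imp_inj_on[OF bij], of j] by (simp add: t_def)
    have "col_map xs y = (\<Sum>w\<in>set xs. t w *\<^sub>R w)" unfolding 1 t by simp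
    moreover have "\<forall>w\<in>set xs. 0 < t w" using that by (simp add: t_def)
    ultimately show ?thesis unfolding gen_cone_def by auto
  qed
  moreover have "(\<Sum>w\<in>set xs. t w *\<^sub>R w) \<in> col_map xs ` {y. \<forall>i. 0 < y $ i}" if "\<forall>w\<in>set xs. 0 < t w" for t
    unfolding 1 using pos[OF that] by (intro imageI) simp
  ultimately show ?thesis by (auto simp: gen_cone_def)
qed

lemma open_gen_cone_basis:
  fixes xs :: "(real ^ 'd::{finite,linorder}) list"
  assumes "length xs = CARD('d)" "det_cols xs \<noteq> 0"
  shows "open (gen_cone 0 (set xs))"
proof -
  have "distinct xs" using assms det_cols_nz_iff by blast
  have "surj (col_map xs)"
    using assms linear_col_map linear_injective_imp_surjective det_nz_iff_inj det_col_map by metis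
  moreover have "open {y::real ^ 'd::_. \<forall>i. 0 < y $ i}"
  proof -
    have "{y::real ^ 'd::_. \<forall>i. 0 < y $ i} = (\<Inter>i. {y. 0 < y $ i})" by auto
    thus ?thesis by (auto intro!: open_INT open_Collect_less continuous_intros)
  qed
  ultimately show ?thesis
    unfolding gen_cone_col_map[OF \<open>distinct xs\<close> assms(1)]
    by (intro open_surjective_linear_image linear_col_map)
qed

text \<open>Substituting \<open>col_map xs\<close> turns the cone into the orthant and
  \<open>x \<bullet> \<xi>\<close> into a linear form with coefficients
  \<open>w \<bullet> \<xi>\<close>, so the integral factorizes.\<close>

theorem nn_integral_gen_cone_basis:
  fixes xs :: "(real ^ 'd::{finite,linorder}) list"
  assumes len: "length xs = CARD('d)" and det: "det_cols xs \<noteq> 0" and pos: "\<And>w. w \<in> set xs \<Longrightarrow> 0 < w \<bullet> \<xi>"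
  shows "(\<integral>\<^sup>+x. ennreal (exp (- (x \<bullet> \<xi>)) * indicator (gen_cone 0 (set xs)) x) \<partial>lborel)
       = ennreal (\<bar>det_cols xs\<bar> / (\<Prod>w\<in>set xs. w \<bullet> \<xi>))"
proof -
  have dist: "distinct xs" using assms det_cols_nz_iff by blast
  note bij = bij_nth_col_rank[OF dist len]
  have inj: "inj (col_map xs)" using det det_nz_iff_inj[OF linear_col_map] det_col_map by metis
  have [measurable]: "gen_cone 0 (set xs) \<in> sets borel" using open_gen_cone_basis[OF len det] by simp
  have ind: "indicator (gen_cone 0 (set xs)) (col_map xs y) = (indicator {y. \<forall>i. 0 < y $ i} y :: real)" for y
    using inj by (auto simp: gen_cone_col_map[OF dist len] indicator_def inj_image_mem_iff)
  have expo: "col_map xs y \<bullet> \<xi> = (\<Sum>i\<in>UNIV. ((xs ! col_rank i) \<bullet> \<xi>) * y $ i)" for y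
    by (simp add: col_map_def inner_sum_left mult.commute)
  have "(\<integral>\<^sup>+x. ennreal (exp (- (x \<bullet> \<xi>)) * indicator (gen_cone 0 (set xs)) x) \<partial>lborel)
      = ennreal \<bar>det_cols xs\<bar> *
        (\<integral>\<^sup>+y. ennreal (exp (- (\<Sum>i\<in>UNIV. ((xs ! col_rank i) \<bullet> \<xi>) * (y :: real ^ 'd::_) $ i)) * indicator {y. \<forall>i. 0 < y $ i} y) \<partial>lborel)"
    using det
    by (subst nn_integral_linear_substitution[OF linear_col_map[of xs]]) (simp_all add: det_col_map ind expo)
  also have "\<dots> = ennreal \<bar>det_cols xs\<bar> * ennreal (1 / (\<Prod>i\<in>(UNIV :: 'd set). (xs ! col_rank i) \<bullet> \<xi>))"
    using pos bij by (subst nn_integral_exp_orthant) (auto dest: bij_betwE)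
  also have "(\<Prod>i\<in>(UNIV :: 'd set). (xs ! col_rank i) \<bullet> \<xi>) = (\<Prod>w\<in>set xs. w \<bullet> \<xi>)"
    by (rule prod.reindex_bij_betw[OF bij])
  finally show ?thesis
    by (simp add: ennreal_mult'[symmetric])
qed

section \<open>Regular triangulations of cones\<close>

definition is_basis :: "(real ^ 'd) set \<Rightarrow> bool" where
  "is_basis \<sigma> \<longleftrightarrow> independent \<sigma> \<and> card \<sigma> = CARD('d)"

lemma is_basisD:
  assumes "is_basis (\<sigma> :: (real ^ 'd) set)"
  shows "finite \<sigma>" "independent \<sigma>" "span \<sigma> = UNIV" "card \<sigma> = CARD('d)"
proof -
  show *: "independent \<sigma>" "card \<sigma> = CARD('d)" using assms by (auto simp: is_basis_def)
  show "finite \<sigma>" using * by (simp add: independent_imp_finite)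
  show "span \<sigma> = UNIV"
    using card_ge_dim_independent[of \<sigma> UNIV] * by auto
qed

lemma sum_representation_basis:
  assumes "is_basis \<sigma>"
  shows "(\<Sum>w\<in>\<sigma>. representation \<sigma> x w *\<^sub>R w) = x"
  using is_basisD[OF assms] by (intro sum_representation_eq) auto

lemma linear_representation_basis:
  assumes "is_basis \<sigma>"
  shows "linear (\<lambda>x. representation \<sigma> x w)"
  using is_basisD[OF assms] real_vector.linear_representation[of \<sigma> w]
  by (auto intro!: linearI simp: real_vector.representation_add real_vector.representation_scale)

lemma representation_sum_basis:
  assumes "is_basis \<sigma>" "w \<in> \<sigma>"
  shows "representation \<sigma> (\<Sum>u\<in>\<sigma>. t u *\<^sub>R u) w = t w"
proof -
  have "representation \<sigma> (\<Sum>u\<in>\<sigma>. t u *\<^sub>R u) w = (\<Sum>u\<in>\<sigma>. t u * representation \<sigma> u w)"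
    by (simp add: linear_sum[OF linear_representation_basis[OF assms(1)]]
        linear_cmul[OF linear_representation_basis[OF assms(1)]])
  also have "\<dots> = (\<Sum>u\<in>\<sigma>. if u = w then t u else 0)"
    using is_basisD[OF assms(1)] by (intro sum.cong) (auto simp: representation_basis)
  also have "\<dots> = t w" using is_basisD[OF assms(1)] assms(2) by (simp add: sum.delta)
  finally show ?thesis .
qed

lemma gen_cone_0_iff: "x \<in> gen_cone 0 W \<longleftrightarrow> (\<exists>t. (\<forall>w\<in>W. 0 < t w) \<and> x = (\<Sum>w\<in>W. t w *\<^sub>R w))"
  by (auto simp: gen_cone_def)

lemma gen_cone_basis_iff:
  assumes "is_basis \<sigma>"
  shows "x \<in> gen_cone 0 \<sigma> \<longleftrightarrow> (\<forall>w\<in>\<sigma>. 0 < representation \<sigma> x w)"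
proof
  assume "x \<in> gen_cone 0 \<sigma>"
  thus "\<forall>w\<in>\<sigma>. 0 < representation \<sigma> x w"
    by (auto simp: gen_cone_0_iff representation_sum_basis[OF assms])
next
  assume "\<forall>w\<in>\<sigma>. 0 < representation \<sigma> x w"
  thus "x \<in> gen_cone 0 \<sigma>"
    unfolding gen_cone_0_iff by (intro exI[of _ "representation \<sigma> x"]) (simp add: sum_representation_basis[OF assms])
qed

lemma open_gen_cone_is_basis:
  assumes "is_basis \<sigma>"
  shows "open (gen_cone 0 \<sigma>)"
proof -
  have "gen_cone 0 \<sigma> = (\<Inter>w\<in>\<sigma>. {x. 0 < representation \<sigma> x w})"
    using gen_cone_basis_iff[OF assms] by auto
  thus ?thesis
    using is_basisD(1)[OF assms] linear_representation_basis[OF assms]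
    by (auto intro!: open_INT open_Collect_less linear_continuous_on simp: linear_linear)
qed

text \<open>Such a point lies on no wall of any simplicial cone with rays in \<open>W\<close>; in
  linear programming terms, all its basic solutions are nondegenerate.\<close>

definition generic_point :: "(real ^ 'd) set \<Rightarrow> real ^ 'd \<Rightarrow> bool" where
  "generic_point W x \<longleftrightarrow> (\<forall>A\<subseteq>W. card A < CARD('d) \<longrightarrow> x \<notin> span A)"

text \<open>Too few vectors, a linear dependence or a vanishing coefficient would each place
  \<open>x\<close> in the span of fewer than \<open>CARD('d)\<close> generators.\<close>

lemma generic_point_basis:
  fixes x :: "real ^ 'd"
  assumes "generic_point W x" "A \<subseteq> W" "finite A" "card A \<le> CARD('d)"
    and x: "x = (\<Sum>w\<in>A. t w *\<^sub>R w)"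
  shows "is_basis A" "w \<in> A \<Longrightarrow> t w \<noteq> 0"
proof -
  have no: "x \<notin> span (A - {w})" if "w \<in> A" for w
  proof -
    have "card (A - {w}) < CARD('d)" using that assms(3,4) by (metis card_Diff1_less less_le_trans)
    moreover have "A - {w} \<subseteq> W" using assms(2) by auto
    ultimately show ?thesis using assms(1) unfolding generic_point_def by blast
  qed
  have sp: "x \<in> span A" unfolding x by (intro span_sum span_scale span_base)
  hence "\<not> card A < CARD('d)" using assms(1,2) unfolding generic_point_def by blast
  hence "card A = CARD('d)" using assms(4) by simp
  moreover have "independent A"
  proof
    assume "dependent A"
    then obtain a where "a \<in> A" "a \<in> span (A - {a})" by (auto simp: dependent_def)
    hence "span A = span (A - {a})" by (metis insert_Diff span_redundant)
    with no[OF \<open>a \<in> A\<close>] sp show False by simp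
  qed
  ultimately show "is_basis A" by (simp add: is_basis_def)
  show "t w \<noteq> 0" if "w \<in> A"
  proof
    assume "t w = 0"
    hence "x = (\<Sum>w\<in>A - {w}. t w *\<^sub>R w)" unfolding x using that assms(3) by (simp add: sum.remove)
    hence "x \<in> span (A - {w})" by (simp only:) (intro span_sum span_scale span_base)
    with no[OF that] show False by simp
  qed
qed

text \<open>As in the simplex method, \<theta> is the least quotient \<open>t u / b u\<close> with
  \<open>b u\<close> positive: the longest step that keeps every coefficient nonnegative. It is
  attained at \<open>u0\<close>, whose coefficient drops to zero.\<close>

lemma ratio_test:
  fixes t b :: "'a \<Rightarrow> real"
  assumes "finite A" "\<And>u. u \<in> A \<Longrightarrow> 0 < t u" "u \<in> A" "0 < b u"
  obtains \<theta> u0 where "0 < \<theta>" "u0 \<in> A" "t u0 - \<theta> * b u0 = 0" "\<And>u. u \<in> A \<Longrightarrow> 0 \<le> t u - \<theta> * b u" "0 < b u0"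
proof -
  let ?P = "{u \<in> A. 0 < b u}"
  let ?m = "Min ((\<lambda>u. t u / b u) ` ?P)"
  have P: "finite ?P" "?P \<noteq> {}" using assms by auto
  have "?m \<in> (\<lambda>u. t u / b u) ` ?P" using P by (intro Min_in) auto
  then obtain u0 where u0: "u0 \<in> A" "0 < b u0" "?m = t u0 / b u0" by auto
  show ?thesis
  proof (rule that[of ?m u0])
    show m: "0 < ?m" using u0 assms(2) by simp
    show "t u0 - ?m * b u0 = 0" using u0 by simp
    show "0 \<le> t u - ?m * b u" if "u \<in> A" for u
    proof (cases "0 < b u")
      case True
      hence "?m \<le> t u / b u" using that P by (intro Min_le) auto
      thus ?thesis using True by (simp add: pos_le_divide_eq)
    next
      case False
      hence "?m * b u \<le> 0" using m by (simp add: mult_le_0_iff)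
      thus ?thesis using assms(2)[OF that] by simp
    qed
  qed (use u0 in auto)
qed

lemma conic_caratheodory:
  fixes x :: "real ^ 'd"
  assumes "finite W" "x \<in> gen_cone 0 W"
  shows "\<exists>A\<subseteq>W. independent A \<and> x \<in> gen_cone 0 A"
  using assms
proof (induction "card W" arbitrary: W rule: less_induct)
  case less
  show ?case
  proof (cases "independent W")
    case False
    obtain t where t: "\<And>w. w \<in> W \<Longrightarrow> 0 < t w" "x = (\<Sum>w\<in>W. t w *\<^sub>R w)"
      using less.prems by (auto simp: gen_cone_0_iff)
    obtain a0 w0 where a0: "(\<Sum>w\<in>W. a0 w *\<^sub>R w) = 0" "w0 \<in> W" "a0 w0 \<noteq> 0"
      using False less.prems(1) by (auto simp: dependent_finite)
    \<comment> \<open>The ratio test needs a positive entry, so the relation gets the sign that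
      makes the entry at \<open>w0\<close> positive.\<close>
    define a where "a = (\<lambda>w. sgn (a0 w0) * a0 w)"
    have a: "(\<Sum>w\<in>W. a w *\<^sub>R w) = 0" "0 < a w0"
      using a0 by (auto simp: a_def scaleR_scaleR[symmetric] scaleR_right.sum[symmetric] sgn_if simp del: scaleR_scaleR)
    obtain \<theta> u0 where \<theta>: "u0 \<in> W" "t u0 - \<theta> * a u0 = 0" "\<And>u. u \<in> W \<Longrightarrow> 0 \<le> t u - \<theta> * a u"
      using ratio_test[of W t w0 a] less.prems(1) t(1) a0(2) a(2) by metis
    \<comment> \<open>\<open>gen_cone\<close> demands strictly positive coefficients, so exactly the
      generators that keep one are retained; \<open>u0\<close> is lost and the induction
      applies.\<close>
    define V where "V = {w \<in> W. 0 < t w - \<theta> * a w}"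
    have "x = (\<Sum>w\<in>W. (t w - \<theta> * a w) *\<^sub>R w)"
      using t(2) a(1)
      by (simp add: scaleR_left_diff_distrib sum_subtractf scaleR_scaleR[symmetric] scaleR_right.sum[symmetric] del: scaleR_scaleR)
    also have "\<dots> = (\<Sum>w\<in>V. (t w - \<theta> * a w) *\<^sub>R w)"
      using less.prems(1) \<theta>(3) by (intro sum.mono_neutral_right) (force simp: V_def)+
    finally have "x \<in> gen_cone 0 V"
      unfolding gen_cone_0_iff by (intro exI[of _ "\<lambda>w. t w - \<theta> * a w"]) (simp add: V_def)
    moreover have "u0 \<notin> V" using \<theta>(2) by (simp add: V_def)
    hence "V \<subset> W" using \<theta>(1) by (auto simp: V_def)
    ultimately show ?thesis
      using less.hyps[of V] less.prems(1) psubset_card_mono[of W V]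
      by (meson finite_subset order_trans psubset_imp_subset)
  qed (use less.prems in auto)
qed

text \<open>
  The values \<open>h\<close> are distinct powers of one number that avoids the roots of finitely many
  nonzero polynomials.
\<close>

lemma avoid_linear_relations:
  fixes F :: "('a \<Rightarrow> real) set"
  assumes "finite W" "finite F" "\<And>c. c \<in> F \<Longrightarrow> \<exists>u\<in>W. c u \<noteq> 0"
  obtains h where "\<And>u. (0::real) < h u" "\<And>c. c \<in> F \<Longrightarrow> (\<Sum>u\<in>W. c u * h u) \<noteq> 0"
proof -
  obtain e where e: "bij_betw e {..<card W} W"
    using assms(1) by (metis bij_betw_from_nat_into_finite)
  define idx where "idx = the_inv_into {..<card W} e"
  have idx: "idx (e i) = i" if "i < card W" for i
    using e that by (simp add: idx_def the_inv_into_f_f bij_betw_def)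
  have eq: "(\<Sum>u\<in>W. c u * s ^ idx u) = (\<Sum>i\<le>card W. (if i < card W then c (e i) else 0) * s ^ i)" for c :: "'a \<Rightarrow> real" and s
  proof -
    have "(\<Sum>u\<in>W. c u * s ^ idx u) = (\<Sum>i<card W. c (e i) * s ^ i)"
      unfolding sum.reindex_bij_betw[OF e, symmetric] by (intro sum.cong) (auto simp: idx)
    also have "\<dots> = (\<Sum>i\<le>card W. (if i < card W then c (e i) else 0) * s ^ i)"
      by (intro sum.mono_neutral_cong_left) auto
    finally show ?thesis .
  qed
  have fin: "finite {s. (\<Sum>u\<in>W. c u * s ^ idx u) = 0}" if c: "c \<in> F" for c
  proof -
    obtain u where "u \<in> W" "c u \<noteq> 0" using assms(3)[OF c] by auto
    moreover from this e have "u \<in> e ` {..<card W}" by (simp add: bij_betw_def)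
    ultimately obtain i where "i < card W" "c (e i) \<noteq> 0" by auto
    thus ?thesis unfolding eq polyfun_finite_roots by (intro exI[of _ i]) auto
  qed
  have "infinite ({0<..} - (\<Union>c\<in>F. {s. (\<Sum>u\<in>W. c u * s ^ idx u) = 0}) :: real set)"
    using assms(2) fin by (intro Diff_infinite_finite finite_UN_I) (auto simp: infinite_Ioi)
  then obtain s :: real where "s \<in> {0<..} - (\<Union>c\<in>F. {s. (\<Sum>u\<in>W. c u * s ^ idx u) = 0})"
    using infinite_imp_nonempty by blast
  thus ?thesis using that[of "\<lambda>u. s ^ idx u"] by auto
qed

text \<open>Two readings are used: for fixed \<open>x\<close> it is the cost of expressing
  \<open>x\<close> in the basis; as a function of \<open>x\<close> it is the linear functional that
  interpolates \<open>h\<close> on the basis, the dual solution.\<close>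

definition height_ext :: "(real ^ 'd \<Rightarrow> real) \<Rightarrow> (real ^ 'd) set \<Rightarrow> real ^ 'd \<Rightarrow> real" where
  "height_ext h \<sigma> x = (\<Sum>u\<in>\<sigma>. representation \<sigma> x u * h u)"

text \<open>The inequality says that all reduced costs \<open>h w - height_ext h \<sigma> w\<close>
  are positive, that is, strict dual feasibility.\<close>

definition regular_triangulation :: "(real ^ 'd \<Rightarrow> real) \<Rightarrow> (real ^ 'd) set \<Rightarrow> (real ^ 'd) set set" where
  "regular_triangulation h W = {\<sigma>. \<sigma> \<subseteq> W \<and> is_basis \<sigma> \<and> (\<forall>w\<in>W - \<sigma>. height_ext h \<sigma> w < h w)}"

lemma linear_height_ext:
  assumes "is_basis \<sigma>" shows "linear (height_ext h \<sigma>)"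
  by (auto intro!: linearI simp: height_ext_def linear_add[OF linear_representation_basis[OF assms]]
      linear_cmul[OF linear_representation_basis[OF assms]] sum.distrib sum_distrib_left algebra_simps)

lemma height_ext_sum:
  assumes "is_basis \<sigma>"
  shows "height_ext h \<sigma> (\<Sum>u\<in>\<sigma>. t u *\<^sub>R u) = (\<Sum>u\<in>\<sigma>. t u * h u)"
  by (simp add: height_ext_def representation_sum_basis[OF assms])

lemma height_ext_base:
  assumes "is_basis \<sigma>" "w \<in> \<sigma>"
  shows "height_ext h \<sigma> w = h w"
proof -
  have "height_ext h \<sigma> w = (\<Sum>u\<in>\<sigma>. if u = w then h u else 0)"
    unfolding height_ext_def using is_basisD[OF assms(1)] assms(2)
    by (intro sum.cong) (auto simp: representation_basis)
  thus ?thesis using is_basisD[OF assms(1)] assms(2) by (simp add: sum.delta)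
qed

text \<open>Weak duality: in the positive expansion of \<open>x\<close> over \<tau>, the functional
  of \<sigma> is at most \<open>h\<close> at every element, and strictly less at an element outside
  \<sigma>.\<close>

lemma height_ext_less:
  assumes \<sigma>: "\<sigma> \<in> regular_triangulation h W" and \<tau>: "\<tau> \<subseteq> W" "is_basis \<tau>" "x \<in> gen_cone 0 \<tau>" "\<not> \<tau> \<subseteq> \<sigma>"
  shows "height_ext h \<sigma> x < height_ext h \<tau> x"
proof -
  have \<sigma>': "is_basis \<sigma>" using \<sigma> by (simp add: regular_triangulation_def)
  obtain t where t: "\<And>w. w \<in> \<tau> \<Longrightarrow> 0 < t w" "x = (\<Sum>w\<in>\<tau>. t w *\<^sub>R w)"
    using \<tau>(3) by (auto simp: gen_cone_0_iff)
  have le: "height_ext h \<sigma> w \<le> h w" "w \<notin> \<sigma> \<Longrightarrow> height_ext h \<sigma> w < h w" if "w \<in> \<tau>" for w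
    using that \<sigma> \<tau>(1) height_ext_base[OF \<sigma>', of w h]
    by (cases "w \<in> \<sigma>"; force simp: regular_triangulation_def)+
  obtain w0 where w0: "w0 \<in> \<tau>" "w0 \<notin> \<sigma>" using \<tau>(4) by auto
  have "height_ext h \<sigma> x = (\<Sum>w\<in>\<tau>. t w * height_ext h \<sigma> w)"
    unfolding t(2) using linear_height_ext[OF \<sigma>'] by (simp add: linear_sum linear_cmul)
  also have "\<dots> < (\<Sum>w\<in>\<tau>. t w * h w)"
  proof (rule sum_strict_mono_ex1)
    show "\<forall>w\<in>\<tau>. t w * height_ext h \<sigma> w \<le> t w * h w"
      using t(1) le by (simp add: less_imp_le mult_left_mono)
    show "\<exists>w\<in>\<tau>. t w * height_ext h \<sigma> w < t w * h w"
      using w0 t(1) le by (intro bexI[of _ w0]) auto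
  qed (use is_basisD \<tau>(2) in auto)
  also have "\<dots> = height_ext h \<tau> x" unfolding t(2) height_ext_sum[OF \<tau>(2)] ..
  finally show ?thesis .
qed

text \<open>Distinct bases have equal size, so neither contains the other, and weak duality gives
  contradictory strict inequalities.\<close>

lemma regular_triangulation_unique:
  assumes \<sigma>: "\<sigma> \<in> regular_triangulation h W" "x \<in> gen_cone 0 \<sigma>"
    and \<tau>: "\<tau> \<in> regular_triangulation h W" "x \<in> gen_cone 0 \<tau>"
  shows "\<sigma> = \<tau>"
proof (rule ccontr)
  assume ne: "\<sigma> \<noteq> \<tau>"
  have *: "is_basis \<sigma>" "\<sigma> \<subseteq> W" "is_basis \<tau>" "\<tau> \<subseteq> W"
    using \<sigma> \<tau> by (auto simp: regular_triangulation_def)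
  hence "\<not> \<sigma> \<subseteq> \<tau>" "\<not> \<tau> \<subseteq> \<sigma>"
    using ne card_subset_eq is_basisD(1,4) by metis+
  hence "height_ext h \<sigma> x < height_ext h \<tau> x" "height_ext h \<tau> x < height_ext h \<sigma> x"
    using height_ext_less \<sigma> \<tau> * by metis+
  thus False by simp
qed

text \<open>Among the bases whose cone contains \<open>x\<close>, a cheapest one is dual feasible: a
  generator \<open>w\<close> with negative reduced cost could be pivoted in at lower cost.\<close>

lemma regular_triangulation_covers:
  fixes x :: "real ^ 'd"
  assumes W: "finite W" and pos: "\<And>w. w \<in> W \<Longrightarrow> 0 < w \<bullet> \<xi>"
    and h: "\<And>\<sigma> w. \<lbrakk>\<sigma> \<subseteq> W; is_basis \<sigma>; w \<in> W - \<sigma>\<rbrakk> \<Longrightarrow> height_ext h \<sigma> w \<noteq> h w"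
    and x: "generic_point W x" "x \<in> gen_cone 0 W"
  shows "\<exists>\<sigma>\<in>regular_triangulation h W. x \<in> gen_cone 0 \<sigma>"
proof -
  let ?S = "{\<sigma>. \<sigma> \<subseteq> W \<and> is_basis \<sigma> \<and> x \<in> gen_cone 0 \<sigma>}"
  obtain A where A: "A \<subseteq> W" "independent A" "x \<in> gen_cone 0 A"
    using conic_caratheodory[OF W x(2)] by auto
  have "card A \<le> CARD('d)" "finite A"
    using independent_bound[OF A(2)] by auto
  hence "is_basis A" using generic_point_basis(1)[OF x(1) A(1)] A(3) by (auto simp: gen_cone_0_iff)
  hence S: "finite ?S" "?S \<noteq> {}" using A W by auto
  define \<sigma> where "\<sigma> = arg_min_on (\<lambda>\<sigma>. height_ext h \<sigma> x) ?S"
  have \<sigma>: "\<sigma> \<subseteq> W" "is_basis \<sigma>" "x \<in> gen_cone 0 \<sigma>"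
    using arg_min_if_finite(1)[OF S] unfolding \<sigma>_def by auto
  have min: "height_ext h \<sigma> x \<le> height_ext h \<tau> x" if "\<tau> \<subseteq> W" "is_basis \<tau>" "x \<in> gen_cone 0 \<tau>" for \<tau>
    using arg_min_least[OF S, of \<tau> "\<lambda>\<sigma>. height_ext h \<sigma> x"] that unfolding \<sigma>_def by auto
  note fin = is_basisD(1)[OF \<sigma>(2)]
  have "height_ext h \<sigma> w < h w" if w: "w \<in> W - \<sigma>" for w
  proof (rule ccontr)
    assume "\<not> ?thesis"
    \<comment> \<open>Genericity of the heights excludes equality.\<close>
    hence gt: "h w < height_ext h \<sigma> w" using h[OF \<sigma>(1,2) w] by simp
    define b where "b = representation \<sigma> w"
    define t where "t = representation \<sigma> x"
    have t: "0 < t u" if "u \<in> \<sigma>" for u using \<sigma> that by (simp add: gen_cone_basis_iff t_def)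
    have wb: "w = (\<Sum>u\<in>\<sigma>. b u *\<^sub>R u)" and xt: "x = (\<Sum>u\<in>\<sigma>. t u *\<^sub>R u)"
      using sum_representation_basis[OF \<sigma>(2)] by (simp_all add: b_def t_def)
    \<comment> \<open>This is where \<xi> bounds the pivot: if no coefficient of \<open>w\<close>
      were positive, then \<open>w \<bullet> \<xi>\<close> could not be.\<close>
    have "\<exists>u\<in>\<sigma>. 0 < b u"
    proof (rule ccontr)
      assume "\<not> ?thesis"
      moreover have "0 < u \<bullet> \<xi>" if "u \<in> \<sigma>" for u using that \<sigma>(1) pos by auto
      ultimately have "(\<Sum>u\<in>\<sigma>. b u * (u \<bullet> \<xi>)) \<le> 0"
        by (intro sum_nonpos) (simp add: mult_nonpos_nonneg not_less less_imp_le)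
      moreover have "w \<bullet> \<xi> = (\<Sum>u\<in>\<sigma>. b u * (u \<bullet> \<xi>))"
        by (subst wb) (simp add: inner_sum_left)
      ultimately show False using pos[of w] w by simp
    qed
    then obtain \<theta> u0 where \<theta>: "0 < \<theta>" "u0 \<in> \<sigma>" "t u0 - \<theta> * b u0 = 0" "\<And>u. u \<in> \<sigma> \<Longrightarrow> 0 \<le> t u - \<theta> * b u"
      using ratio_test[of \<sigma> t _ b] fin t by metis
    define \<tau> where "\<tau> = insert w (\<sigma> - {u0})"
    \<comment> \<open>The coefficients of \<open>x\<close> after \<open>w\<close> enters with weight
      \<theta>: in the identity \<open>x = \<theta> w + (x - \<theta> w)\<close>, the last term is
      expanded in \<sigma> and \<open>u0\<close> drops out.\<close>
    define r where "r = (\<lambda>u. if u = w then \<theta> else t u - \<theta> * b u)"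
    have rsum: "(\<Sum>u\<in>\<tau>. r u *\<^sub>R u) = \<theta> *\<^sub>R w + (\<Sum>u\<in>\<sigma>. (t u - \<theta> * b u) *\<^sub>R u)"
      "(\<Sum>u\<in>\<tau>. r u * h u) = \<theta> * h w + (\<Sum>u\<in>\<sigma>. (t u - \<theta> * b u) * h u)"
    proof -
      have "(\<Sum>u\<in>\<sigma> - {u0}. r u *\<^sub>R u) = (\<Sum>u\<in>\<sigma> - {u0}. (t u - \<theta> * b u) *\<^sub>R u)"
        "(\<Sum>u\<in>\<sigma> - {u0}. r u * h u) = (\<Sum>u\<in>\<sigma> - {u0}. (t u - \<theta> * b u) * h u)"
        using w by (auto intro!: sum.cong simp: r_def split: if_splits)
      thus "(\<Sum>u\<in>\<tau>. r u *\<^sub>R u) = \<theta> *\<^sub>R w + (\<Sum>u\<in>\<sigma>. (t u - \<theta> * b u) *\<^sub>R u)"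
        "(\<Sum>u\<in>\<tau>. r u * h u) = \<theta> * h w + (\<Sum>u\<in>\<sigma>. (t u - \<theta> * b u) * h u)"
        using w fin \<theta>(2,3) by (simp_all add: \<tau>_def r_def sum.remove[of \<sigma> u0])
    qed
    have "(\<Sum>u\<in>\<sigma>. (t u - \<theta> * b u) *\<^sub>R u) = x - \<theta> *\<^sub>R w"
      by (subst wb, subst xt) (simp add: scaleR_left_diff_distrib sum_subtractf scaleR_right.sum)
    hence xr: "x = (\<Sum>u\<in>\<tau>. r u *\<^sub>R u)" using rsum(1) by simp
    have sub: "\<tau> \<subseteq> W" "finite \<tau>" using w \<sigma>(1) fin by (auto simp: \<tau>_def)
    have card: "card \<tau> \<le> CARD('d)"
      using w fin \<theta>(2) is_basisD(4)[OF \<sigma>(2)] by (simp add: \<tau>_def card_Diff_singleton card_gt_0_iff)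
    \<comment> \<open>Genericity of \<open>x\<close> alone shows that the exchanged set is a basis
      and that no new coefficient vanishes.\<close>
    note \<tau> = generic_point_basis[OF x(1) sub card xr]
    have "0 \<le> r u" if "u \<in> \<tau>" for u using that \<theta> by (auto simp: r_def \<tau>_def)
    hence "x \<in> gen_cone 0 \<tau>"
      unfolding gen_cone_0_iff using xr \<tau>(2) by (intro exI[of _ r]) (auto simp: less_le)
    hence "height_ext h \<sigma> x \<le> height_ext h \<tau> x" using min[OF sub(1) \<tau>(1)] by simp
    also have "height_ext h \<tau> x = \<theta> * h w + (\<Sum>u\<in>\<sigma>. (t u - \<theta> * b u) * h u)"
      using height_ext_sum[OF \<tau>(1), of h r] xr rsum(2) by simp
    \<comment> \<open>The pivot changes the cost by \<theta> times the reduced cost of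
      \<open>w\<close>, which is negative.\<close>
    also have "\<dots> = \<theta> * h w + height_ext h \<sigma> x - \<theta> * height_ext h \<sigma> w"
      by (simp add: height_ext_def b_def t_def algebra_simps sum_subtractf sum_distrib_left)
    finally have "\<theta> * height_ext h \<sigma> w \<le> \<theta> * h w" by simp
    thus False using gt \<theta>(1) by simp
  qed
  thus ?thesis using \<sigma> by (auto simp: regular_triangulation_def)
qed

lemma exists_triangulation:
  fixes W :: "(real ^ 'd) set"
  assumes W: "finite W" and pos: "\<And>w. w \<in> W \<Longrightarrow> 0 < w \<bullet> \<xi>"
  obtains T where "finite T" "\<And>\<sigma>. \<sigma> \<in> T \<Longrightarrow> \<sigma> \<subseteq> W \<and> is_basis \<sigma>"
    "\<And>\<sigma> \<tau> x. \<lbrakk>\<sigma> \<in> T; \<tau> \<in> T; x \<in> gen_cone 0 \<sigma>; x \<in> gen_cone 0 \<tau>\<rbrakk> \<Longrightarrow> \<sigma> = \<tau>"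
    "\<And>x. \<lbrakk>generic_point W x; x \<in> gen_cone 0 W\<rbrakk> \<Longrightarrow> \<exists>\<sigma>\<in>T. x \<in> gen_cone 0 \<sigma>"
proof -
  define P where "P = {(\<sigma>, w). \<sigma> \<subseteq> W \<and> is_basis \<sigma> \<and> w \<in> W - \<sigma>}"
  \<comment> \<open>The condition \<open>height_ext h \<sigma> w \<noteq> h w\<close> is linear in
    the values of \<open>h\<close>; its coefficient vector is nonzero, with entry -1 at
    \<open>w\<close>, because \<open>w\<close> lies outside \<sigma>.\<close>
  define c where "c = (\<lambda>(\<sigma> :: (real ^ 'd) set, w) u. representation \<sigma> w u - (if u = w then 1 else 0 :: real))"
  have "P \<subseteq> Pow W \<times> W" by (auto simp: P_def)
  hence "finite (c ` P)" using W by (simp add: finite_subset)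
  moreover have "\<exists>u\<in>W. f u \<noteq> 0" if f: "f \<in> c ` P" for f
  proof -
    obtain p where p: "p \<in> P" "f = c p" using f by blast
    moreover obtain \<sigma> w where "p = (\<sigma>, w)" by (cases p)
    ultimately have "(\<sigma>, w) \<in> P" "f = c (\<sigma>, w)" by auto
    moreover have "representation \<sigma> w w = 0" if "w \<notin> \<sigma>" using that representation_ne_zero by blast
    ultimately show ?thesis by (intro bexI[of _ w]) (auto simp: c_def P_def)
  qed
  ultimately obtain h :: "real ^ 'd \<Rightarrow> real" where h: "\<And>f. f \<in> c ` P \<Longrightarrow> (\<Sum>u\<in>W. f u * h u) \<noteq> 0"
    using avoid_linear_relations[OF W, of "c ` P"] by metis
  have h': "height_ext h \<sigma> w \<noteq> h w" if "\<sigma> \<subseteq> W" "is_basis \<sigma>" "w \<in> W - \<sigma>" for \<sigma> w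
  proof -
    have "(\<Sum>u\<in>W. c (\<sigma>, w) u * h u) = (\<Sum>u\<in>W. representation \<sigma> w u * h u) - (\<Sum>u\<in>W. if u = w then h u else 0)"
      unfolding sum_subtractf[symmetric] by (intro sum.cong) (auto simp: c_def algebra_simps)
    also have "(\<Sum>u\<in>W. if u = w then h u else 0) = h w" using W that by simp
    also have "(\<Sum>u\<in>W. representation \<sigma> w u * h u) = height_ext h \<sigma> w"
      unfolding height_ext_def using W that representation_ne_zero[of \<sigma> w]
      by (intro sum.mono_neutral_right) auto
    finally show ?thesis using h[of "c (\<sigma>, w)"] that by (auto simp: P_def)
  qed
  show ?thesis
  proof (rule that[of "regular_triangulation h W"])
    have "regular_triangulation h W \<subseteq> Pow W" by (auto simp: regular_triangulation_def)
    thus "finite (regular_triangulation h W)" using W by (simp add: finite_subset)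
    show "\<exists>\<sigma>\<in>regular_triangulation h W. x \<in> gen_cone 0 \<sigma>" if "generic_point W x" "x \<in> gen_cone 0 W" for x
      using regular_triangulation_covers[OF W pos h' that] by blast
    show "\<sigma> = \<tau>" if "\<sigma> \<in> regular_triangulation h W" "\<tau> \<in> regular_triangulation h W"
      "x \<in> gen_cone 0 \<sigma>" "x \<in> gen_cone 0 \<tau>" for \<sigma> \<tau> x
      using regular_triangulation_unique[OF that(1,3,2,4)] .
  qed (auto simp: regular_triangulation_def)
qed

section \<open>Homogeneous polynomials\<close>

lemma finite_exponents: "finite {\<alpha> :: 'd::finite \<Rightarrow> nat. (\<Sum>i\<in>UNIV. \<alpha> i) = m}"
proof (rule finite_subset)
  show "{\<alpha> :: 'd \<Rightarrow> nat. (\<Sum>i\<in>UNIV. \<alpha> i) = m} \<subseteq> PiE UNIV (\<lambda>_. {..m})"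
    by (auto intro: member_le_sum)
qed (auto intro: finite_PiE)

lemma homogeneous_poly_monomial:
  fixes \<alpha> :: "'d::finite \<Rightarrow> nat"
  assumes "(\<Sum>i\<in>UNIV. \<alpha> i) = m"
  shows "homogeneous_poly m (\<lambda>\<xi>. a * (\<Prod>i\<in>UNIV. (\<xi> $ i) ^ \<alpha> i))"
  unfolding homogeneous_poly_def
proof (intro exI[of _ "\<lambda>\<beta>. if \<beta> = \<alpha> then a else 0"] allI)
  fix \<xi> :: "real ^ 'd"
  have "(\<Sum>\<beta> | (\<Sum>i\<in>UNIV. \<beta> i) = m. (if \<beta> = \<alpha> then a else 0) * (\<Prod>i\<in>UNIV. (\<xi> $ i) ^ \<beta> i))
      = (\<Sum>\<beta> | (\<Sum>i\<in>UNIV. \<beta> i) = m. if \<beta> = \<alpha> then a * (\<Prod>i\<in>UNIV. (\<xi> $ i) ^ \<alpha> i) else 0)"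
    by (intro sum.cong) auto
  also have "\<dots> = a * (\<Prod>i\<in>UNIV. (\<xi> $ i) ^ \<alpha> i)"
    using assms by (simp add: sum.delta finite_exponents)
  finally show "a * (\<Prod>i\<in>UNIV. (\<xi> $ i) ^ \<alpha> i) =
      (\<Sum>\<beta> | (\<Sum>i\<in>UNIV. \<beta> i) = m. (if \<beta> = \<alpha> then a else 0) * (\<Prod>i\<in>UNIV. (\<xi> $ i) ^ \<beta> i))" ..
qed

lemma homogeneous_poly_0: "homogeneous_poly m (\<lambda>\<xi>. 0)"
  unfolding homogeneous_poly_def by (intro exI[of _ "\<lambda>_. 0"]) simp

lemma homogeneous_poly_add:
  assumes "homogeneous_poly m p" "homogeneous_poly m q"
  shows "homogeneous_poly m (\<lambda>\<xi>. p \<xi> + q \<xi>)"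
proof -
  obtain c d where cd: "\<And>\<xi>. p \<xi> = (\<Sum>\<alpha> | (\<Sum>i\<in>UNIV. \<alpha> i) = m. c \<alpha> * (\<Prod>i\<in>UNIV. (\<xi> $ i) ^ \<alpha> i))"
    "\<And>\<xi>. q \<xi> = (\<Sum>\<alpha> | (\<Sum>i\<in>UNIV. \<alpha> i) = m. d \<alpha> * (\<Prod>i\<in>UNIV. (\<xi> $ i) ^ \<alpha> i))"
    using assms unfolding homogeneous_poly_def by auto
  show ?thesis
    unfolding homogeneous_poly_def
    by (intro exI[of _ "\<lambda>\<alpha>. c \<alpha> + d \<alpha>"]) (simp add: cd sum.distrib[symmetric] distrib_right)
qed

lemma homogeneous_poly_sum:
  assumes "\<And>i. i \<in> I \<Longrightarrow> homogeneous_poly m (p i)"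
  shows "homogeneous_poly m (\<lambda>\<xi>. \<Sum>i\<in>I. p i \<xi>)"
  using assms by (induction I rule: infinite_finite_induct) (auto intro: homogeneous_poly_add homogeneous_poly_0)

text \<open>Multiplication by one coordinate of \<xi> raises one exponent of each monomial by one;
  the linear form is a sum of such steps.\<close>

lemma homogeneous_poly_mult_inner:
  assumes "homogeneous_poly m p"
  shows "homogeneous_poly (Suc m) (\<lambda>\<xi>. p \<xi> * (w \<bullet> \<xi>))"
proof -
  obtain c where c: "\<And>\<xi>. p \<xi> = (\<Sum>\<alpha> | (\<Sum>i\<in>UNIV. \<alpha> i) = m. c \<alpha> * (\<Prod>i\<in>UNIV. (\<xi> $ i) ^ \<alpha> i))"
    using assms unfolding homogeneous_poly_def by auto
  have shift: "(\<Prod>j\<in>UNIV. (\<xi> $ j) ^ (\<alpha>(i := Suc (\<alpha> i))) j) = (\<xi> $ i) * (\<Prod>j\<in>UNIV. (\<xi> $ j) ^ \<alpha> j)"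
    for \<xi> :: "real ^ 'a" and \<alpha> i
  proof -
    have "(\<Prod>j\<in>UNIV - {i}. (\<xi> $ j) ^ (\<alpha>(i := Suc (\<alpha> i))) j) = (\<Prod>j\<in>UNIV - {i}. (\<xi> $ j) ^ \<alpha> j)"
      by (intro prod.cong) auto
    thus ?thesis by (simp add: prod.remove[of UNIV i])
  qed
  have deg: "(\<Sum>j\<in>UNIV. (\<alpha>(i := Suc (\<alpha> i))) j) = Suc m" if "(\<Sum>j\<in>UNIV. \<alpha> j) = m" for \<alpha> and i :: 'a
  proof -
    have "(\<Sum>j\<in>UNIV - {i}. (\<alpha>(i := Suc (\<alpha> i))) j) = (\<Sum>j\<in>UNIV - {i}. \<alpha> j)"
      by (intro sum.cong) auto
    thus ?thesis using that by (simp add: sum.remove[of UNIV i])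
  qed
  have "(\<lambda>\<xi>. p \<xi> * (w \<bullet> \<xi>)) = (\<lambda>\<xi>. \<Sum>\<alpha> | (\<Sum>i\<in>UNIV. \<alpha> i) = m. \<Sum>i\<in>UNIV.
      (c \<alpha> * w $ i) * (\<Prod>j\<in>UNIV. (\<xi> $ j) ^ (\<alpha>(i := Suc (\<alpha> i))) j))"
    unfolding shift c by (simp add: inner_vec_def sum_product mult_ac) (intro ext sum.swap)
  moreover have "homogeneous_poly (Suc m) \<dots>"
    by (intro homogeneous_poly_sum homogeneous_poly_monomial deg) simp
  ultimately show ?thesis by simp
qed

lemma homogeneous_poly_prod_inner:
  assumes "finite B"
  shows "homogeneous_poly (card B) (\<lambda>\<xi>. a * (\<Prod>w\<in>B. w \<bullet> \<xi>))"
  using assms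
proof (induction B)
  case empty
  show ?case using homogeneous_poly_monomial[of "\<lambda>_. 0" 0 a] by simp
next
  case (insert w B)
  show ?case using homogeneous_poly_mult_inner[OF insert.IH, of w] insert by (simp add: mult_ac)
qed

lemma homogeneous_poly_imp_real_polynomial_function:
  assumes "homogeneous_poly m p"
  shows "real_polynomial_function p"
proof -
  obtain c where "p = (\<lambda>\<xi>. \<Sum>\<alpha> | (\<Sum>i\<in>UNIV. \<alpha> i) = m. c \<alpha> * (\<Prod>i\<in>UNIV. (\<xi> $ i) ^ \<alpha> i))"
    using assms unfolding homogeneous_poly_def by auto
  thus ?thesis
    by (simp only:)
       (intro real_polynomial_function_sum real_polynomial_function.intros(2,4)
        real_polynomial_function_prod real_polynomial_function_power finite_exponents finite
        real_polynomial_function.intros(1) bounded_linear_vec_nth)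
qed

text \<open>On the line through \<open>x0\<close> and \<open>x\<close> the difference is a
  polynomial in one variable that vanishes near parameter 0, hence has infinitely many roots and
  vanishes at parameter 1.\<close>

lemma real_polynomial_function_eqI:
  fixes p q :: "'a::euclidean_space \<Rightarrow> real"
  assumes p: "real_polynomial_function p" and q: "real_polynomial_function q"
    and U: "open U" "x0 \<in> U" and eq: "\<And>x. x \<in> U \<Longrightarrow> p x = q x"
  shows "p = q"
proof
  fix x
  let ?l = "\<lambda>s::real. x0 + s *\<^sub>R (x - x0)"
  have l: "polynomial_function ?l"
    by (intro polynomial_function_add polynomial_function_mult) auto
  have "real_polynomial_function (\<lambda>x. p x - q x)" using p q by (rule real_polynomial_function_diff)
  from real_polynomial_function_compose[OF l this]
  have "real_polynomial_function (\<lambda>s. p (?l s) - q (?l s))" by (simp add: o_def)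
  then obtain a n where "(\<lambda>s. p (?l s) - q (?l s)) = (\<lambda>s. \<Sum>i\<le>n. a i * s ^ i)"
    using real_polynomial_function_imp_sum by blast
  hence a: "p (?l s) - q (?l s) = (\<Sum>i\<le>n. a i * s ^ i)" for s by metis
  have "open (?l -` U)" using U(1) by (intro open_vimage continuous_intros)
  moreover have "0 \<in> ?l -` U" using U(2) by simp
  ultimately have "infinite (?l -` U)"
    using not_open_singleton finite_imp_not_open by (metis empty_iff)
  moreover have "?l -` U \<subseteq> {s. (\<Sum>i\<le>n. a i * s ^ i) = 0}" using eq by (auto simp: a[symmetric])
  ultimately have "\<not> finite {s. (\<Sum>i\<le>n. a i * s ^ i) = 0}" using finite_subset by blast
  hence "\<forall>i\<le>n. a i = 0" unfolding polyfun_finite_roots by blast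
  hence "p (?l 1) - q (?l 1) = 0" unfolding a by simp
  thus "p x = q x" by simp
qed

section \<open>The polynomial of a triangulated cone\<close>

text \<open>A translate of a proper subspace is Lebesgue negligible; being closed it is Borel, which
  makes it a null set of \<open>lborel\<close>.\<close>

lemma AE_not_in_translated_span:
  fixes A :: "(real ^ 'd) set"
  assumes "finite A" "card A < CARD('d)"
  shows "AE x in lborel. x - v \<notin> span A"
proof -
  have "dim (span A) < DIM(real ^ 'd)"
    using assms dim_le_card'[of A] by simp
  hence "negligible ((+) v ` span A)" by (intro negligible_translation negligible_lowdim)
  hence "(+) v ` span A \<in> null_sets lebesgue" by (simp add: negligible_iff_null_sets)
  moreover have "closed ((+) v ` span A)" by (intro closed_translation closed_span)
  hence "(+) v ` span A \<in> sets lborel" by simp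
  ultimately have "(+) v ` span A \<in> null_sets lborel" by (simp add: null_sets_completion_iff)
  from AE_not_in[OF this] show ?thesis
    by eventually_elim (metis add_diff_cancel_left' add.commute diff_add_cancel image_eqI)
qed

lemma AE_generic_point:
  fixes W :: "(real ^ 'd) set"
  assumes "finite W"
  shows "AE x in lborel. generic_point W x"
proof -
  have "AE x in lborel. \<forall>A\<in>{A. A \<subseteq> W \<and> card A < CARD('d)}. x \<notin> span A"
  proof (rule AE_finite_allI)
    fix A assume "A \<in> {A. A \<subseteq> W \<and> card A < CARD('d)}"
    thus "AE x in lborel. x \<notin> span A"
      using AE_not_in_translated_span[of A 0] finite_subset[OF _ assms] by simp
  qed (use assms in simp)
  thus ?thesis by eventually_elim (auto simp: generic_point_def)
qed

text \<open>Any subset of the generators can be split off as a Minkowski summand. This yields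
  openness of the cone, and membership by setting aside a small multiple of the other
  generators.\<close>

lemma gen_cone_split:
  assumes "finite W" "\<sigma> \<subseteq> W"
  shows "gen_cone 0 W = (\<Union>z\<in>gen_cone 0 (W - \<sigma>). (+) z ` gen_cone 0 \<sigma>)"
proof (intro equalityI subsetI)
  fix x assume "x \<in> gen_cone 0 W"
  then obtain t where t: "\<forall>w\<in>W. 0 < t w" "x = (\<Sum>w\<in>W. t w *\<^sub>R w)" by (auto simp: gen_cone_0_iff)
  have "x = (\<Sum>w\<in>W - \<sigma>. t w *\<^sub>R w) + (\<Sum>w\<in>\<sigma>. t w *\<^sub>R w)"
    unfolding t(2) by (rule sum.subset_diff[OF assms(2,1)])
  moreover have "(\<Sum>w\<in>W - \<sigma>. t w *\<^sub>R w) \<in> gen_cone 0 (W - \<sigma>)" "(\<Sum>w\<in>\<sigma>. t w *\<^sub>R w) \<in> gen_cone 0 \<sigma>"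
    using t(1) assms(2) by (auto simp: gen_cone_0_iff)
  ultimately show "x \<in> (\<Union>z\<in>gen_cone 0 (W - \<sigma>). (+) z ` gen_cone 0 \<sigma>)" by blast
next
  fix x assume "x \<in> (\<Union>z\<in>gen_cone 0 (W - \<sigma>). (+) z ` gen_cone 0 \<sigma>)"
  then obtain s t where st: "\<forall>w\<in>W - \<sigma>. 0 < s w" "\<forall>w\<in>\<sigma>. 0 < t w"
    "x = (\<Sum>w\<in>W - \<sigma>. s w *\<^sub>R w) + (\<Sum>w\<in>\<sigma>. t w *\<^sub>R w)" by (auto simp: gen_cone_0_iff)
  let ?r = "\<lambda>w. if w \<in> \<sigma> then t w else s w"
  have "(\<Sum>w\<in>W. ?r w *\<^sub>R w) = (\<Sum>w\<in>W - \<sigma>. ?r w *\<^sub>R w) + (\<Sum>w\<in>\<sigma>. ?r w *\<^sub>R w)"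
    by (rule sum.subset_diff[OF assms(2,1)])
  also have "\<dots> = x" unfolding st(3) by (intro arg_cong2[where f = "(+)"] sum.cong) auto
  finally show "x \<in> gen_cone 0 W" unfolding gen_cone_0_iff using st(1,2) by (intro exI[of _ ?r]) auto
qed

lemma open_gen_cone:
  assumes "finite W" "\<sigma> \<subseteq> W" "is_basis \<sigma>"
  shows "open (gen_cone 0 W)"
  unfolding gen_cone_split[OF assms(1,2)]
  by (intro open_UN ballI open_translation open_gen_cone_is_basis assms)

lemma gen_cone_scaled_sum:
  assumes "0 < \<delta>" shows "\<delta> *\<^sub>R (\<Sum>w\<in>A. w) \<in> gen_cone 0 A"
  unfolding gen_cone_0_iff by (intro exI[of _ "\<lambda>_. \<delta>"]) (use assms in \<open>simp add: scaleR_right.sum\<close>)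

text \<open>The point is that all generators in \<open>W\<close> must get positive coefficients. A
  small multiple of the sum of those outside \<sigma> is subtracted; openness keeps the rest in the
  simplicial cone.\<close>

lemma gen_cone_basis_subset:
  assumes "finite W" "\<sigma> \<subseteq> W" "is_basis \<sigma>"
  shows "gen_cone 0 \<sigma> \<subseteq> gen_cone 0 W"
proof
  fix x assume x: "x \<in> gen_cone 0 \<sigma>"
  let ?s = "\<Sum>w\<in>W - \<sigma>. w"
  have "((\<lambda>\<delta>. x - \<delta> *\<^sub>R ?s) \<longlongrightarrow> x - 0 *\<^sub>R ?s) (at_right 0)" by (intro tendsto_intros)
  hence "eventually (\<lambda>\<delta>. x - \<delta> *\<^sub>R ?s \<in> gen_cone 0 \<sigma>) (at_right 0)"
    using open_gen_cone_is_basis[OF assms(3)] x by (auto dest: topological_tendstoD)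
  moreover have "eventually (\<lambda>\<delta>::real. 0 < \<delta>) (at_right 0)" by (simp add: eventually_at_right_less)
  ultimately have "eventually (\<lambda>\<delta>. 0 < \<delta> \<and> x - \<delta> *\<^sub>R ?s \<in> gen_cone 0 \<sigma>) (at_right 0)"
    by eventually_elim simp
  then obtain \<delta> where \<delta>: "0 < \<delta>" "x - \<delta> *\<^sub>R ?s \<in> gen_cone 0 \<sigma>"
    by (metis (no_types, lifting) eventually_happens trivial_limit_at_right_real)
  have "x = \<delta> *\<^sub>R ?s + (x - \<delta> *\<^sub>R ?s)" by simp
  with \<delta> gen_cone_scaled_sum[OF \<delta>(1), of "W - \<sigma>"] show "x \<in> gen_cone 0 W"
    unfolding gen_cone_split[OF assms(1,2)] by blast
qed

text \<open>Stated through indicators at generic points, the decomposition can be both integrated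
  and evaluated pointwise on the two sides of a diagonal.\<close>

definition triangulates :: "(real ^ 'd) set set \<Rightarrow> (real ^ 'd) set \<Rightarrow> bool" where
  "triangulates T W \<longleftrightarrow> finite T \<and> (\<forall>\<sigma>\<in>T. \<sigma> \<subseteq> W \<and> is_basis \<sigma>) \<and>
     (\<forall>x. generic_point W x \<longrightarrow>
        indicator (gen_cone 0 W) x = (\<Sum>\<sigma>\<in>T. indicator (gen_cone 0 \<sigma>) x :: real))"

lemma triangulatesD:
  assumes "triangulates T W"
  shows "finite T" "\<And>\<sigma>. \<sigma> \<in> T \<Longrightarrow> \<sigma> \<subseteq> W \<and> is_basis \<sigma>"
    "\<And>x. generic_point W x \<Longrightarrow> indicator (gen_cone 0 W) x = (\<Sum>\<sigma>\<in>T. indicator (gen_cone 0 \<sigma>) x :: real)"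
  using assms unfolding triangulates_def by auto

lemma exists_triangulates:
  fixes W :: "(real ^ 'd) set"
  assumes W: "finite W" and pos: "\<And>w. w \<in> W \<Longrightarrow> 0 < w \<bullet> \<xi>"
  shows "\<exists>T. triangulates T W"
proof (rule exists_triangulation[OF W pos])
  fix T
  assume T: "finite T" "\<And>\<sigma>. \<sigma> \<in> T \<Longrightarrow> \<sigma> \<subseteq> W \<and> is_basis \<sigma>"
      "\<And>\<sigma> \<tau> x. \<lbrakk>\<sigma> \<in> T; \<tau> \<in> T; x \<in> gen_cone 0 \<sigma>; x \<in> gen_cone 0 \<tau>\<rbrakk> \<Longrightarrow> \<sigma> = \<tau>"
      "\<And>x. \<lbrakk>generic_point W x; x \<in> gen_cone 0 W\<rbrakk> \<Longrightarrow> \<exists>\<sigma>\<in>T. x \<in> gen_cone 0 \<sigma>"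
  have "indicator (gen_cone 0 W) x = (\<Sum>\<sigma>\<in>T. indicator (gen_cone 0 \<sigma>) x :: real)" if gen: "generic_point W x" for x
  proof (cases "x \<in> gen_cone 0 W")
    case True
    then obtain \<sigma> where \<sigma>: "\<sigma> \<in> T" "x \<in> gen_cone 0 \<sigma>" using T(4) gen by blast
    have "(\<Sum>\<tau>\<in>T. indicator (gen_cone 0 \<tau>) x :: real) = (\<Sum>\<tau>\<in>T. if \<tau> = \<sigma> then 1 else 0)"
      using \<sigma> T(3) by (intro sum.cong) (auto simp: indicator_def)
    thus ?thesis using \<sigma>(1) T(1) True by simp
  next
    case False
    have "x \<notin> gen_cone 0 \<sigma>" if "\<sigma> \<in> T" for \<sigma>
      using False gen_cone_basis_subset[OF W] T(2)[OF that] by blast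
    thus ?thesis using False by simp
  qed
  hence "triangulates T W" using T(1,2) by (simp add: triangulates_def)
  thus ?thesis ..
qed auto

section \<open>Integrating over the simplices and identifying the polynomial\<close>

definition abs_det_set :: "(real ^ 'd::{finite,linorder}) set \<Rightarrow> real" where
  "abs_det_set \<sigma> = \<bar>det_cols (SOME xs. distinct xs \<and> set xs = \<sigma>)\<bar>"

lemma is_basis_list:
  fixes xs :: "(real ^ 'd::{finite,linorder}) list"
  assumes "is_basis \<sigma>" "distinct xs" "set xs = \<sigma>"
  shows "length xs = CARD('d)" "det_cols xs \<noteq> 0"
proof -
  show "length xs = CARD('d)" using assms is_basisD(4) distinct_card by metis
  thus "det_cols xs \<noteq> 0" using assms is_basisD(2) det_cols_nz_iff by blast
qed

text \<open>
  Independence of the order of the list follows from the integral formula: both lists give the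
  integral over the same cone.
\<close>

lemma abs_det_set_list:
  fixes xs :: "(real ^ 'd::{finite,linorder}) list"
  assumes "is_basis \<sigma>" "distinct xs" "set xs = \<sigma>" and pos: "\<And>w. w \<in> \<sigma> \<Longrightarrow> 0 < w \<bullet> \<xi>"
  shows "abs_det_set \<sigma> = \<bar>det_cols xs\<bar>"
proof -
  define ys where "ys = (SOME xs. distinct xs \<and> set xs = \<sigma>)"
  have ys: "distinct ys \<and> set ys = \<sigma>"
    unfolding ys_def by (rule someI[of _ xs]) (use assms(2,3) in simp)
  have P: "0 < (\<Prod>w\<in>\<sigma>. w \<bullet> \<xi>)" using pos by (intro prod_pos) auto
  have "ennreal (\<bar>det_cols ys\<bar> / (\<Prod>w\<in>\<sigma>. w \<bullet> \<xi>)) = ennreal (\<bar>det_cols xs\<bar> / (\<Prod>w\<in>\<sigma>. w \<bullet> \<xi>))"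
    using nn_integral_gen_cone_basis[of xs \<xi>] nn_integral_gen_cone_basis[of ys \<xi>] ys assms
      is_basis_list[OF assms(1)] by simp
  hence "\<bar>det_cols ys\<bar> / (\<Prod>w\<in>\<sigma>. w \<bullet> \<xi>) = \<bar>det_cols xs\<bar> / (\<Prod>w\<in>\<sigma>. w \<bullet> \<xi>)"
    using P by (subst (asm) ennreal_inj) auto
  thus ?thesis using P by (simp add: abs_det_set_def ys_def)
qed

lemma nn_integral_gen_cone_is_basis:
  fixes \<sigma> :: "(real ^ 'd::{finite,linorder}) set"
  assumes "is_basis \<sigma>" "\<And>w. w \<in> \<sigma> \<Longrightarrow> 0 < w \<bullet> \<xi>"
  shows "(\<integral>\<^sup>+x. ennreal (exp (- (x \<bullet> \<xi>)) * indicator (gen_cone 0 \<sigma>) x) \<partial>lborel)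
       = ennreal (abs_det_set \<sigma> / (\<Prod>w\<in>\<sigma>. w \<bullet> \<xi>))"
proof -
  obtain xs where xs: "distinct xs" "set xs = \<sigma>"
    using is_basisD(1)[OF assms(1)] finite_distinct_list by metis
  show ?thesis
    using nn_integral_gen_cone_basis[OF is_basis_list[OF assms(1) xs], of \<xi>] assms(2)
      abs_det_set_list[OF assms(1) xs assms(2)] xs by simp
qed

lemma nn_integral_gen_cone:
  fixes W :: "(real ^ 'd::{finite,linorder}) set"
  assumes W: "finite W" and pos: "\<And>w. w \<in> W \<Longrightarrow> 0 < w \<bullet> \<xi>"
    and tri: "triangulates T W"
  shows "(\<integral>\<^sup>+x. ennreal (exp (- (x \<bullet> \<xi>)) * indicator (gen_cone 0 W) x) \<partial>lborel)
       = ennreal ((\<Sum>\<sigma>\<in>T. abs_det_set \<sigma> * (\<Prod>w\<in>W - \<sigma>. w \<bullet> \<xi>)) / (\<Prod>w\<in>W. w \<bullet> \<xi>))"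
proof -
  note T = triangulatesD[OF tri]
  have "(\<integral>\<^sup>+x. ennreal (exp (- (x \<bullet> \<xi>)) * indicator (gen_cone 0 W) x) \<partial>lborel)
      = (\<integral>\<^sup>+x. (\<Sum>\<sigma>\<in>T. ennreal (exp (- (x \<bullet> \<xi>)) * indicator (gen_cone 0 \<sigma>) x)) \<partial>lborel)"
    using AE_generic_point[OF W]
    by (intro nn_integral_cong_AE, eventually_elim) (simp add: T(3) sum_distrib_left sum_ennreal)
  also have "\<dots> = (\<Sum>\<sigma>\<in>T. \<integral>\<^sup>+x. ennreal (exp (- (x \<bullet> \<xi>)) * indicator (gen_cone 0 \<sigma>) x) \<partial>lborel)"
  proof (rule nn_integral_sum)
    fix \<sigma> assume "\<sigma> \<in> T"
    hence [measurable]: "gen_cone 0 \<sigma> \<in> sets borel"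
      using T(2) by (simp add: borel_open open_gen_cone_is_basis)
    show "(\<lambda>x. ennreal (exp (- (x \<bullet> \<xi>)) * indicator (gen_cone 0 \<sigma>) x)) \<in> borel_measurable lborel"
      by measurable
  qed
  also have "\<dots> = (\<Sum>\<sigma>\<in>T. ennreal (abs_det_set \<sigma> / (\<Prod>w\<in>\<sigma>. w \<bullet> \<xi>)))"
    using T(2) pos by (intro sum.cong nn_integral_gen_cone_is_basis) auto
  also have "\<dots> = (\<Sum>\<sigma>\<in>T. ennreal (abs_det_set \<sigma> * (\<Prod>w\<in>W - \<sigma>. w \<bullet> \<xi>) / (\<Prod>w\<in>W. w \<bullet> \<xi>)))"
  proof (intro sum.cong refl arg_cong[where f = ennreal])
    fix \<sigma> assume "\<sigma> \<in> T"
    hence "\<sigma> \<subseteq> W" using T(2) by auto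
    moreover have "(\<Prod>w\<in>W - \<sigma>. w \<bullet> \<xi>) \<noteq> 0"
      using W pos by (force simp: prod_zero_iff)
    ultimately show "abs_det_set \<sigma> / (\<Prod>w\<in>\<sigma>. w \<bullet> \<xi>) = abs_det_set \<sigma> * (\<Prod>w\<in>W - \<sigma>. w \<bullet> \<xi>) / (\<Prod>w\<in>W. w \<bullet> \<xi>)"
      using prod.subset_diff[OF _ W, of \<sigma> "\<lambda>w. w \<bullet> \<xi>"] by simp
  qed
  also have "\<dots> = ennreal (\<Sum>\<sigma>\<in>T. abs_det_set \<sigma> * (\<Prod>w\<in>W - \<sigma>. w \<bullet> \<xi>) / (\<Prod>w\<in>W. w \<bullet> \<xi>))"
    using pos T(2)
    by (intro sum_ennreal divide_nonneg_nonneg mult_nonneg_nonneg prod_nonneg)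
       (auto simp: abs_det_set_def less_imp_le)
  finally show ?thesis by (simp add: sum_divide_distrib)
qed

lemma set_integral_gen_cone:
  fixes W :: "(real ^ 'd::{finite,linorder}) set"
  assumes W: "finite W" and pos: "\<And>w. w \<in> W \<Longrightarrow> 0 < w \<bullet> \<xi>"
    and tri: "triangulates T W"
  shows "(LINT x : gen_cone v W | lborel. exp (- ((x - v) \<bullet> \<xi>)))
       = (\<Sum>\<sigma>\<in>T. abs_det_set \<sigma> * (\<Prod>w\<in>W - \<sigma>. w \<bullet> \<xi>)) / (\<Prod>w\<in>W. w \<bullet> \<xi>)"
proof -
  note T = triangulatesD[OF tri]
  let ?G = "\<lambda>y. exp (- (y \<bullet> \<xi>)) * indicator (gen_cone 0 W) y"
  have G: "indicator (gen_cone v W) x *\<^sub>R exp (- ((x - v) \<bullet> \<xi>)) = ?G (x - v)" for x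
  proof -
    have "x \<in> gen_cone v W \<longleftrightarrow> x - v \<in> gen_cone 0 W" by (auto simp: gen_cone_def algebra_simps)
    thus ?thesis by (simp add: indicator_def)
  qed
  show ?thesis
  \<comment> \<open>If \<open>W\<close> contains a basis, the cone is open and thus measurable. If
    not, it lies in a translate of a proper subspace: the integral vanishes, matching the empty sum
    over \<open>T\<close>.\<close>
  proof (cases "\<exists>\<sigma>\<subseteq>W. is_basis \<sigma>")
    case True
    then obtain \<sigma> where "\<sigma> \<subseteq> W" "is_basis \<sigma>" by auto
    hence [measurable]: "gen_cone 0 W \<in> sets borel" using open_gen_cone[OF W] by (simp add: borel_open)
    have "(LINT x : gen_cone v W | lborel. exp (- ((x - v) \<bullet> \<xi>))) = (LINT x | lborel. ?G (x - v))"
      unfolding set_lebesgue_integral_def G ..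
    also have "\<dots> = (LINT y | lborel. ?G (v + y - v))"
      by (subst lborel_distr_plus[of v, symmetric]) (rule integral_distr; measurable)
    also have "\<dots> = (LINT y | lborel. ?G y)" by simp
    also have "\<dots> = enn2real (\<integral>\<^sup>+y. ennreal (?G y) \<partial>lborel)"
      by (rule integral_eq_nn_integral) auto
    also have "\<dots> = (\<Sum>\<sigma>\<in>T. abs_det_set \<sigma> * (\<Prod>w\<in>W - \<sigma>. w \<bullet> \<xi>)) / (\<Prod>w\<in>W. w \<bullet> \<xi>)"
    proof -
      have "(\<integral>\<^sup>+y. ennreal (?G y) \<partial>lborel)
          = ennreal ((\<Sum>\<sigma>\<in>T. abs_det_set \<sigma> * (\<Prod>w\<in>W - \<sigma>. w \<bullet> \<xi>)) / (\<Prod>w\<in>W. w \<bullet> \<xi>))"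
        by (rule nn_integral_gen_cone[OF W pos tri])
      moreover have "0 \<le> (\<Sum>\<sigma>\<in>T. abs_det_set \<sigma> * (\<Prod>w\<in>W - \<sigma>. w \<bullet> \<xi>)) / (\<Prod>w\<in>W. w \<bullet> \<xi>)"
        using pos
        by (intro divide_nonneg_nonneg sum_nonneg mult_nonneg_nonneg prod_nonneg)
           (auto simp: abs_det_set_def less_imp_le)
      ultimately show ?thesis by simp
    qed
    finally show ?thesis .
  next
    case False
    hence "T = {}" using T(2) by auto
    obtain B where B: "B \<subseteq> W" "independent B" "W \<subseteq> span B" "card B = dim W"
      using basis_exists by blast
    have "card B < CARD('d)"
      using False B(1,2) independent_card_le[OF B(2)] unfolding is_basis_def by (metis DIM_cart DIM_real mult_1_right le_neq_implies_less)
    hence "AE x in lborel. x - v \<notin> span B"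
      using B(1) W finite_subset by (intro AE_not_in_translated_span) auto
    moreover have "gen_cone 0 W \<subseteq> span B"
    proof -
      have "(\<Sum>w\<in>W. t w *\<^sub>R w) \<in> span B" for t
        using B(3) by (intro span_sum span_scale) auto
      thus ?thesis by (auto simp: gen_cone_0_iff)
    qed
    ultimately have "AE x in lborel. ?G (x - v) = 0"
      by (elim eventually_mono) (auto simp: indicator_def dest: subsetD)
    hence "(LINT x | lborel. ?G (x - v)) = 0" by (rule integral_eq_zero_AE)
    thus ?thesis unfolding set_lebesgue_integral_def G by (simp add: \<open>T = {}\<close>)
  qed
qed

text \<open>The definite description needs uniqueness: two candidates agree on the region of
  convergence, which is open and contains \<open>\<xi>0\<close>, and polynomials that agree there
  are equal.\<close>

theorem cone_poly_eq:
  fixes W :: "(real ^ 'd::{finite,linorder}) set"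
  assumes W: "finite W" and pos: "\<And>w. w \<in> W \<Longrightarrow> 0 < w \<bullet> \<xi>0"
    and tri: "triangulates T W"
  shows "cone_poly v W = (\<lambda>\<xi>. \<Sum>\<sigma>\<in>T. abs_det_set \<sigma> * (\<Prod>w\<in>W - \<sigma>. w \<bullet> \<xi>))" (is "_ = ?p")
  unfolding cone_poly_def
proof (rule the_equality)
  note T = triangulatesD[OF tri]
  have hom: "homogeneous_poly (card W - CARD('d)) ?p"
  proof (rule homogeneous_poly_sum)
    fix \<sigma> assume "\<sigma> \<in> T"
    hence "card (W - \<sigma>) = card W - CARD('d)"
      using T(2) is_basisD[of \<sigma>] by (simp add: card_Diff_subset)
    thus "homogeneous_poly (card W - CARD('d)) (\<lambda>\<xi>. abs_det_set \<sigma> * (\<Prod>w\<in>W - \<sigma>. w \<bullet> \<xi>))"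
      using homogeneous_poly_prod_inner[of "W - \<sigma>"] W by (metis finite_Diff)
  qed
  show *: "homogeneous_poly (card W - CARD('d)) ?p \<and> (\<forall>\<xi>. (\<forall>w\<in>W. w \<bullet> \<xi> > 0) \<longrightarrow>
      (LINT x : gen_cone v W | lborel. exp (- ((x - v) \<bullet> \<xi>))) = ?p \<xi> / (\<Prod>w\<in>W. w \<bullet> \<xi>))"
    by (intro conjI hom allI impI set_integral_gen_cone[OF W _ tri]) blast+
  fix q assume q: "homogeneous_poly (card W - CARD('d)) q \<and> (\<forall>\<xi>. (\<forall>w\<in>W. w \<bullet> \<xi> > 0) \<longrightarrow>
      (LINT x : gen_cone v W | lborel. exp (- ((x - v) \<bullet> \<xi>))) = q \<xi> / (\<Prod>w\<in>W. w \<bullet> \<xi>))"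
  show "q = ?p"
  proof (rule real_polynomial_function_eqI)
    have "{\<xi>. \<forall>w\<in>W. w \<bullet> \<xi> > 0} = (\<Inter>w\<in>W. {\<xi>. 0 < w \<bullet> \<xi>})" by auto
    thus "open {\<xi>. \<forall>w\<in>W. w \<bullet> \<xi> > 0}"
      using W by (auto intro!: open_INT open_Collect_less continuous_intros)
    show "\<xi>0 \<in> {\<xi>. \<forall>w\<in>W. w \<bullet> \<xi> > 0}" using pos by simp
    fix \<xi> assume "\<xi> \<in> {\<xi>. \<forall>w\<in>W. w \<bullet> \<xi> > 0}"
    hence \<xi>: "\<forall>w\<in>W. w \<bullet> \<xi> > 0" by simp
    have "q \<xi> / (\<Prod>w\<in>W. w \<bullet> \<xi>) = ?p \<xi> / (\<Prod>w\<in>W. w \<bullet> \<xi>)"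
      using *[THEN conjunct2, THEN spec, THEN mp, OF \<xi>] q[THEN conjunct2, THEN spec, THEN mp, OF \<xi>] by simp
    moreover have "(\<Prod>w\<in>W. w \<bullet> \<xi>) \<noteq> 0" using \<xi> W by (force simp: prod_zero_iff)
    ultimately show "q \<xi> = ?p \<xi>" by simp
  qed (use hom q in \<open>auto intro: homogeneous_poly_imp_real_polynomial_function\<close>)
qed

section \<open>Diagonals and generalized cross products\<close>

text \<open>If 0 were in the convex hull of \<open>W\<close>, adding multiples of a vanishing
  nonnegative combination would let the cone contain a line. Otherwise the compact hull is strictly
  separated from 0.\<close>

lemma strictly_convex_cone_halfspace:
  fixes W :: "(real ^ 'd) set"
  assumes W: "finite W" "0 \<notin> W" and K: "strictly_convex_cone (gen_cone v W)"
  shows "\<exists>\<xi>. \<forall>w\<in>W. 0 < w \<bullet> \<xi>"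
proof -
  have "0 \<notin> convex hull W"
  proof
    assume "0 \<in> convex hull W"
    then obtain u where u: "\<forall>w\<in>W. 0 \<le> u w" "sum u W = 1" "(\<Sum>w\<in>W. u w *\<^sub>R w) = 0"
      using W(1) by (auto simp: convex_hull_finite)
    have "\<exists>w\<in>W. 0 < u w" using u(1,2) sum_nonpos[of W u] by (force simp: not_less)
    then obtain w0 where w0: "w0 \<in> W" "0 < u w0" by auto
    have "(v + (\<Sum>w\<in>W. w)) + t *\<^sub>R w0 \<in> gen_cone v W" for t
    proof -
      \<comment> \<open>1 gives the base point, \<open>t\<close> the displacement along
        \<open>w0\<close>, and the last term a multiple of the vanishing combination, scaled so that
        the coefficient at \<open>w0\<close> is \<open>1 + t + \<bar>t\<bar>\<close>, at least
        1.\<close>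
      define r where "r = (\<lambda>w. 1 + (if w = w0 then t else 0) + (\<bar>t\<bar> / u w0) * u w)"
      have "0 < r w" if "w \<in> W" for w
        using w0 u(1) that by (cases "w = w0") (auto simp: r_def add_pos_nonneg)
      moreover have "(\<Sum>w\<in>W. r w *\<^sub>R w) = (\<Sum>w\<in>W. w) + t *\<^sub>R w0"
      proof -
        have "(\<Sum>w\<in>W. r w *\<^sub>R w) = (\<Sum>w\<in>W. w) + (\<Sum>w\<in>W. if w = w0 then t *\<^sub>R w else 0)
            + (\<bar>t\<bar> / u w0) *\<^sub>R (\<Sum>w\<in>W. u w *\<^sub>R w)"
          unfolding scaleR_right.sum sum.distrib[symmetric]
          by (intro sum.cong) (auto simp: r_def scaleR_left_distrib)
        thus ?thesis using u(3) w0(1) W(1) by simp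
      qed
      ultimately show ?thesis
        unfolding gen_cone_def by (auto intro!: exI[of _ r] simp: add.assoc)
    qed
    moreover have "w0 \<noteq> 0" using w0 W(2) by auto
    ultimately have "contains_line (gen_cone v W)" unfolding contains_line_def by blast
    thus False using K by (simp add: strictly_convex_cone_def)
  qed
  moreover have "closed (convex hull W)"
    using W(1) by (simp add: compact_convex_hull compact_imp_closed finite_imp_compact)
  ultimately obtain a b where "0 < b" "\<forall>x\<in>convex hull W. a \<bullet> x > b"
    using separating_hyperplane_closed_0[of "convex hull W"] convex_convex_hull by blast
  hence "0 < w \<bullet> a" if "w \<in> W" for w
    using hull_inc[OF that, of convex] by (metis inner_commute less_trans)
  thus ?thesis by blast
qed

text \<open>Ranks start at 0, so the index \<open>k\<close> of rank \<open>CARD('d) - 1\<close>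
  carries the appended vector. Transposing makes it a row, so that linearity of the determinant in a
  row applies.\<close>

lemma det_cols_append1:
  fixes D :: "(real ^ 'd::{finite,linorder}) list" and k :: 'd
  assumes len: "length D = CARD('d) - 1" and k: "col_rank k = CARD('d) - 1"
  shows "det_cols (D @ [x]) = det (\<chi> j. if j = k then x else D ! col_rank j)"
proof -
  have "(D @ [x]) ! card {..<j} = (if j = k then x else D ! col_rank j)" for j :: 'd
  proof (cases "j = k")
    case False
    have "col_rank j < CARD('d)" "col_rank j \<noteq> col_rank k"
      using bij_col_rank False by (auto simp: bij_betw_def inj_on_def)
    hence "col_rank j < length D" using len k by linarith
    thus ?thesis using False by (simp add: nth_append flip: col_rank_def)
  qed (use len k in \<open>simp add: nth_append flip: col_rank_def\<close>)
  thus ?thesis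
    unfolding det_cols_def by (subst det_transpose[symmetric]) (simp add: transpose_def)
qed

lemma gen_cross_inner:
  fixes D :: "(real ^ 'd::{finite,linorder}) list"
  assumes len: "length D = CARD('d) - 1"
  shows "gen_cross D \<bullet> x = det_cols (D @ [x])"
proof -
  have "CARD('d) - 1 \<in> {..<CARD('d)}" by simp
  then obtain k :: 'd where k: "col_rank k = CARD('d) - 1"
    using bij_col_rank unfolding bij_betw_def by (metis imageE)
  note eq = det_cols_append1[OF len k]
  have lin: "linear (\<lambda>x. det_cols (D @ [x]))"
    by (rule linearI) (simp_all add: eq det_row_add det_row_mul[of k, where 'a = real, unfolded scalar_mult_eq_scaleR])
  \<comment> \<open>The Riesz vector of the linear functional, obtained as its adjoint evaluated at
    1.\<close>
  define c where "c = adjoint (\<lambda>x. det_cols (D @ [x])) 1"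
  have c: "\<forall>x. c \<bullet> x = det_cols (D @ [x])"
    using adjoint_works[OF lin, of _ 1] by (simp add: c_def inner_commute)
  have "gen_cross D = c"
    unfolding gen_cross_def
    by (rule the_equality[where P = "\<lambda>c. \<forall>x. c \<bullet> x = det_cols (D @ [x])", OF c]) (metis c vector_eq_ldot inner_commute)
  thus ?thesis using c by simp
qed

lemma gen_cone_in_span:
  assumes "x \<in> gen_cone 0 A" shows "x \<in> span A"
proof -
  obtain t where "x = (\<Sum>w\<in>A. t w *\<^sub>R w)" using assms by (auto simp: gen_cone_0_iff)
  thus ?thesis by (simp only:) (intro span_sum span_scale span_base)
qed

locale cone_diagonal =
  fixes W :: "(real ^ 'd::{finite,linorder}) set" and D :: "(real ^ 'd::{finite,linorder}) list"
  assumes fin: "finite W" and diag: "is_diagonal W D"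
begin

text \<open>This is \<open>D\<^sup>*\<close>: orthogonal to \<open>D\<close>, with
  \<open>w \<bullet> c\<close> equal to the determinant of \<open>D\<close> followed by
  \<open>w\<close>.\<close>

abbreviation c where "c \<equiv> gen_cross D"

lemma D_subset: "set D \<subseteq> W" and card_D: "card (set D) = CARD('d) - 1" and finite_D: "finite (set D)"
  using diag by (auto simp: is_diagonal_def distinct_card)

lemma card_D_less: "card (set D) < CARD('d)"
  unfolding card_D by simp

lemma inner_c: "w \<bullet> c = det_cols (D @ [w])"
  using gen_cross_inner[of D] diag by (metis inner_commute is_diagonal_def)

lemma det_nz_basis:
  assumes "w \<bullet> c \<noteq> 0"
  shows "w \<notin> set D" "is_basis (insert w (set D))" "independent (set D)"
proof -
  have len: "length (D @ [w]) = CARD('d)" using diag by (simp add: is_diagonal_def)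
  have *: "distinct (D @ [w])" "independent (set (D @ [w]))"
    using assms det_cols_nz_iff[OF len] unfolding inner_c by auto
  thus "w \<notin> set D" by auto
  show "is_basis (insert w (set D))"
    using * distinct_card[OF *(1)] len by (simp add: is_basis_def insert_commute)
  show "independent (set D)" by (rule independent_mono[OF *(2)]) auto
qed

lemma inner_c_D: "w \<in> set D \<Longrightarrow> w \<bullet> c = 0"
  using det_nz_basis(1) by blast

lemma inner_c_span: "x \<in> span (set D) \<Longrightarrow> x \<bullet> c = 0"
  by (induction rule: span_induct_alt) (auto simp: inner_add_left inner_c_D)

lemma basis_containing_D:
  assumes "is_basis \<sigma>" "\<sigma> \<subseteq> W" "set D \<subseteq> \<sigma>"
  obtains w where "w \<in> W - set D" "\<sigma> = insert w (set D)"
proof -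
  have "card (\<sigma> - set D) = 1"
    using assms card_D is_basisD[OF assms(1)] by (simp add: card_Diff_subset finite_D Suc_leI)
  then obtain w where "\<sigma> - set D = {w}" by (auto simp: card_Suc_eq elim: card_1_singletonE)
  thus ?thesis using that[of w] assms by blast
qed

text \<open>Pairing with \<open>c\<close> kills the coordinates along \<open>D\<close>; the
  coordinate at \<open>w\<close> thus records the side of the hyperplane on which \<open>x\<close>
  lies.\<close>

lemma inner_c_representation:
  assumes "is_basis (insert w (set D))" "w \<notin> set D"
  shows "x \<bullet> c = representation (insert w (set D)) x w * (w \<bullet> c)"
proof -
  have "x = representation (insert w (set D)) x w *\<^sub>R w + (\<Sum>u\<in>set D. representation (insert w (set D)) x u *\<^sub>R u)"
    using sum_representation_basis[OF assms(1), of x] assms(2) by simp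
  hence "x \<bullet> c = (representation (insert w (set D)) x w *\<^sub>R w + (\<Sum>u\<in>set D. representation (insert w (set D)) x u *\<^sub>R u)) \<bullet> c"
    by (rule arg_cong)
  thus ?thesis by (simp add: inner_add_left inner_sum_left inner_c_D)
qed

text \<open>A simplex that misses some \<open>u\<close> in \<open>D\<close> has the zero factor
  \<open>u \<bullet> c\<close>. For the simplex of \<open>D\<close> and \<open>w\<close>, the volume
  \<bar>w \<bullet> c\<bar> supplies, up to sign, the factor missing from the full product.\<close>

lemma sum_bases_eq:
  assumes T: "triangulates T W" and pos: "\<And>w. w \<in> W \<Longrightarrow> 0 < w \<bullet> \<xi>"
  shows "(\<Sum>\<sigma>\<in>T. abs_det_set \<sigma> * (\<Prod>w\<in>W - \<sigma>. w \<bullet> c))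
     = (\<Sum>w | w \<in> W - set D \<and> insert w (set D) \<in> T. sgn (w \<bullet> c)) * (\<Prod>w\<in>W - set D. w \<bullet> c)"
proof -
  note T = triangulatesD[OF T]
  let ?A = "{w \<in> W - set D. insert w (set D) \<in> T}"
  let ?f = "\<lambda>\<sigma>. abs_det_set \<sigma> * (\<Prod>w\<in>W - \<sigma>. w \<bullet> c)"
  have "(\<Sum>\<sigma>\<in>T. ?f \<sigma>) = (\<Sum>\<sigma> | \<sigma> \<in> T \<and> set D \<subseteq> \<sigma>. ?f \<sigma>)"
  proof (intro sum.mono_neutral_right ballI)
    fix \<sigma> assume "\<sigma> \<in> T - {\<sigma> \<in> T. set D \<subseteq> \<sigma>}"
    then obtain u where "u \<in> set D" "u \<notin> \<sigma>" by auto
    hence "u \<in> W - \<sigma>" "u \<bullet> c = 0" using inner_c_D D_subset by auto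
    hence "\<exists>w\<in>W - \<sigma>. w \<bullet> c = 0" ..
    thus "?f \<sigma> = 0" using fin by (simp add: prod_zero)
  qed (use T(1) in auto)
  also have "\<dots> = (\<Sum>w\<in>?A. ?f (insert w (set D)))"
  proof (rule sum.reindex_cong[of "\<lambda>w. insert w (set D)"])
    show "inj_on (\<lambda>w. insert w (set D)) ?A" by (auto intro!: inj_onI)
    show "{\<sigma> \<in> T. set D \<subseteq> \<sigma>} = (\<lambda>w. insert w (set D)) ` ?A"
    proof (intro equalityI subsetI)
      fix \<sigma> assume \<sigma>: "\<sigma> \<in> {\<sigma> \<in> T. set D \<subseteq> \<sigma>}"
      then obtain w where "w \<in> W - set D" "\<sigma> = insert w (set D)"
        using basis_containing_D[of \<sigma>] T(2)[of \<sigma>] by auto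
      thus "\<sigma> \<in> (\<lambda>w. insert w (set D)) ` ?A" using \<sigma> by auto
    qed auto
  qed simp
  also have "\<dots> = (\<Sum>w\<in>?A. sgn (w \<bullet> c) * (\<Prod>w\<in>W - set D. w \<bullet> c))"
  proof (rule sum.cong)
    fix w assume w: "w \<in> ?A"
    have set: "set (D @ [w]) = insert w (set D)" by simp
    have dist: "distinct (D @ [w])" using w diag by (simp add: is_diagonal_def)
    have "abs_det_set (insert w (set D)) = \<bar>w \<bullet> c\<bar>"
      using abs_det_set_list[OF _ dist set, of \<xi>] T(2)[of "insert w (set D)"] w pos
      unfolding inner_c by auto
    moreover have "(\<Prod>w\<in>W - set D. w \<bullet> c) = (w \<bullet> c) * (\<Prod>w\<in>W - insert w (set D). w \<bullet> c)"
    proof -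
      have "W - set D - {w} = W - insert w (set D)" by auto
      moreover have "w \<in> W - set D" "finite (W - set D)" using w fin by auto
      ultimately show ?thesis using prod.remove[of "W - set D" w "\<lambda>w. w \<bullet> c"] by metis
    qed
    moreover have "\<bar>w \<bullet> c\<bar> = sgn (w \<bullet> c) * (w \<bullet> c)" by (simp add: sgn_if abs_if)
    ultimately show "?f (insert w (set D)) = sgn (w \<bullet> c) * (\<Prod>w\<in>W - set D. w \<bullet> c)" by simp
  qed simp
  finally show ?thesis by (simp add: sum_distrib_right)
qed

text \<open>By dimension, \<open>A\<close> spans the same hyperplane as \<open>D\<close>; by
  \<open>nz\<close> the only generators in it are those of \<open>D\<close>, and independence
  excludes a proper subset.\<close>

lemma span_eq_D:
  assumes nz: "\<forall>w\<in>W - set D. w \<bullet> c \<noteq> 0" and ind: "independent (set D)"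
    and A: "A \<subseteq> W" "card A < CARD('d)" "set D \<subseteq> span A"
  shows "A = set D"
proof -
  have finA: "finite A" using A(1) fin finite_subset by blast
  have "dim (span A) \<le> card (set D)"
    using dim_le_card'[OF finA] A(2) card_D by simp
  hence "span A \<subseteq> span (set D)"
    using card_ge_dim_independent[OF A(3) ind] by (simp add: span_minimal)
  hence "A \<subseteq> span (set D)" using span_superset by blast
  hence "A \<subseteq> set D" using inner_c_span nz A(1) by blast
  thus ?thesis using spanning_subset_independent[OF _ ind A(3)] by blast
qed

text \<open>The span of \<open>D\<close> must be exempted, since it contains \<open>q\<close>;
  moving off along \<open>c\<close> takes care of it.\<close>

definition diagonal_generic where
  "diagonal_generic q \<longleftrightarrow> q \<in> gen_cone 0 (set D) \<and>
     (\<forall>A. A \<subseteq> W \<and> card A < CARD('d) \<and> A \<noteq> set D \<longrightarrow> q \<notin> span A)"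

text \<open>Each forbidden span is killed by a functional that is nonzero somewhere on
  \<open>D\<close>. Avoiding it is a linear condition on the coefficients of \<open>q\<close>, and
  suitable positive coefficients meet all of these conditions.\<close>

lemma exists_diagonal_generic:
  assumes nz: "\<forall>w\<in>W - set D. w \<bullet> c \<noteq> 0" and ind: "independent (set D)"
  shows "\<exists>q. diagonal_generic q"
proof -
  define \<A> where "\<A> = {A. A \<subseteq> W \<and> card A < CARD('d) \<and> A \<noteq> set D}"
  have "\<exists>a. (\<forall>x\<in>span A. a \<bullet> x = 0) \<and> (\<exists>u\<in>set D. a \<bullet> u \<noteq> 0)" if A: "A \<in> \<A>" for A
  proof -
    have "\<not> set D \<subseteq> span A" using span_eq_D[OF nz ind] A by (auto simp: \<A>_def)
    then obtain u where u: "u \<in> set D" "u \<notin> span A" by auto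
    \<comment> \<open>The component \<open>z\<close> of \<open>u\<close> orthogonal to the span is
      the required functional.\<close>
    obtain y z where yz: "y \<in> span A" "\<And>x. x \<in> span A \<Longrightarrow> orthogonal z x" "u = y + z"
      using orthogonal_subspace_decomp_exists[of A u] by metis
    have "z \<noteq> 0" using u(2) yz(1,3) by auto
    moreover have "z \<bullet> u = z \<bullet> z" using yz by (simp add: inner_add_right orthogonal_def)
    ultimately have "z \<bullet> u \<noteq> 0" by simp
    thus ?thesis using yz(2) u(1) by (auto simp: orthogonal_def)
  qed
  then obtain a where a: "\<And>A x. A \<in> \<A> \<Longrightarrow> x \<in> span A \<Longrightarrow> a A \<bullet> x = 0"
    "\<And>A. A \<in> \<A> \<Longrightarrow> \<exists>u\<in>set D. a A \<bullet> u \<noteq> 0" by metis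
  have "finite \<A>" using fin by (simp add: \<A>_def)
  hence "finite ((\<lambda>A u. a A \<bullet> u) ` \<A>)" by simp
  moreover have "\<exists>u\<in>set D. f u \<noteq> 0" if f: "f \<in> (\<lambda>A u. a A \<bullet> u) ` \<A>" for f
    using f a(2) by auto
  ultimately obtain h where h: "\<And>u. 0 < h u" "\<And>f. f \<in> (\<lambda>A u. a A \<bullet> u) ` \<A> \<Longrightarrow> (\<Sum>u\<in>set D. f u * h u) \<noteq> 0"
    using avoid_linear_relations[OF finite_D, of "(\<lambda>A u. a A \<bullet> u) ` \<A>"] by blast
  define q where "q = (\<Sum>u\<in>set D. h u *\<^sub>R u)"
  show ?thesis
    unfolding diagonal_generic_def
  proof (intro exI[of _ q] conjI allI impI)
    show "q \<in> gen_cone 0 (set D)" unfolding gen_cone_0_iff q_def by (intro exI[of _ h]) (simp add: h(1))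
    fix A assume A': "A \<subseteq> W \<and> card A < CARD('d) \<and> A \<noteq> set D"
    show "q \<notin> span A"
    proof
      assume "q \<in> span A"
      moreover have A: "A \<in> \<A>" using A' by (simp add: \<A>_def)
      ultimately have "a A \<bullet> q = 0" using a(1) by blast
      moreover have "a A \<bullet> q = (\<Sum>u\<in>set D. (a A \<bullet> u) * h u)"
        by (simp add: q_def inner_sum_right mult.commute)
      ultimately show False using h(2)[of "\<lambda>u. a A \<bullet> u"] A by auto
    qed
  qed
qed

section \<open>Simplices and the whole cone near a point of the diagonal\<close>

lemma representation_tendsto:
  assumes "is_basis \<sigma>"
  shows "((\<lambda>\<epsilon>. representation \<sigma> (q + \<epsilon> *\<^sub>R x) u) \<longlongrightarrow> representation \<sigma> q u) (at_right 0)"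
proof -
  note L = linear_representation_basis[OF assms, of u]
  have "((\<lambda>\<epsilon>. representation \<sigma> q u + \<epsilon> * representation \<sigma> x u) \<longlongrightarrow> representation \<sigma> q u + 0 * representation \<sigma> x u) (at_right 0)"
    by (intro tendsto_intros)
  thus ?thesis by (simp add: linear_add[OF L] linear_cmul[OF L])
qed

lemma representation_insert_pos:
  assumes "is_basis (insert w (set D))" "w \<notin> set D" "q \<in> gen_cone 0 (set D)" "u \<in> set D"
  shows "0 < representation (insert w (set D)) q u"
proof -
  obtain h where h: "\<forall>u\<in>set D. 0 < h u" "q = (\<Sum>u\<in>set D. h u *\<^sub>R u)"
    using assms(3) by (auto simp: gen_cone_0_iff)
  have "q = (\<Sum>u\<in>insert w (set D). (h(w := 0)) u *\<^sub>R u)"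
    using assms(2) unfolding h(2) by (auto intro!: sum.cong)
  hence "representation (insert w (set D)) q u = (h(w := 0)) u"
    using representation_sum_basis[OF assms(1), of u "h(w := 0)"] assms(4) by simp
  thus ?thesis using h(1) assms(2,4) by auto
qed

lemma eventually_coordinates_pos:
  assumes "is_basis (insert w (set D))" "w \<notin> set D" "q \<in> gen_cone 0 (set D)"
  shows "eventually (\<lambda>\<epsilon>. \<forall>u\<in>set D. 0 < representation (insert w (set D)) (q + \<epsilon> *\<^sub>R x) u) (at_right 0)"
proof (intro eventually_ball_finite ballI finite_set)
  fix u assume "u \<in> set D"
  show "eventually (\<lambda>\<epsilon>. 0 < representation (insert w (set D)) (q + \<epsilon> *\<^sub>R x) u) (at_right 0)"
    by (rule order_tendstoD(1)[OF representation_tendsto[OF assms(1)] representation_insert_pos[OF assms \<open>u \<in> set D\<close>]])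
qed

text \<open>At \<open>q\<close> the coordinates along \<open>D\<close> are positive and stay so for
  small \<epsilon>, while the one at \<open>w\<close> is zero and becomes \<epsilon> times that of
  \<open>x\<close>.\<close>

lemma eventually_mem_simplex_over_diagonal:
  assumes w: "is_basis (insert w (set D))" "w \<notin> set D" and q: "q \<in> gen_cone 0 (set D)"
  shows "eventually (\<lambda>\<epsilon>. q + \<epsilon> *\<^sub>R x \<in> gen_cone 0 (insert w (set D)) \<longleftrightarrow> 0 < representation (insert w (set D)) x w) (at_right 0)"
proof -
  have "w \<bullet> c \<noteq> 0"
  proof
    assume "w \<bullet> c = 0"
    hence "det_cols (D @ [w]) = 0" using inner_c[of w] by simp
    moreover have "distinct (D @ [w])" "length (D @ [w]) = CARD('d)" "independent (set (D @ [w]))"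
      using w diag is_basisD(2)[OF w(1)] by (auto simp: is_diagonal_def)
    ultimately show False using det_cols_nz_iff by blast
  qed
  have q0: "representation (insert w (set D)) q w = 0"
  proof -
    have "q \<in> span (set D)" using gen_cone_in_span q by blast
    hence "q \<bullet> c = 0" by (rule inner_c_span)
    thus ?thesis using inner_c_representation[OF w, of q] \<open>w \<bullet> c \<noteq> 0\<close> by simp
  qed
  note L = linear_representation_basis[OF w(1), of w]
  have "eventually (\<lambda>\<epsilon>::real. 0 < \<epsilon>) (at_right 0)" by (simp add: eventually_at_right_less)
  with eventually_coordinates_pos[OF w q, of x] show ?thesis
  proof eventually_elim
    case (elim \<epsilon>)
    have "representation (insert w (set D)) (q + \<epsilon> *\<^sub>R x) w = \<epsilon> * representation (insert w (set D)) x w"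
      by (simp add: linear_add[OF L] linear_cmul[OF L] q0)
    thus ?case using elim by (simp add: gen_cone_basis_iff[OF w(1)] zero_less_mult_iff)
  qed
qed

lemma c_neq_0:
  assumes "w \<bullet> c \<noteq> 0" shows "0 < c \<bullet> c"
  using assms by auto

text \<open>With generators on both sides, some positive combination \<open>z\<close> of all
  generators outside \<open>D\<close> lies in the hyperplane of \<open>D\<close>. A small multiple
  of \<open>z\<close> can be subtracted from \<open>q\<close> without leaving the cone over
  \<open>D\<close>.\<close>

lemma diagonal_subset_cone:
  assumes w1: "w1 \<in> W" "0 < w1 \<bullet> c" and w2: "w2 \<in> W" "w2 \<bullet> c < 0"
  shows "gen_cone 0 (set D) \<subseteq> gen_cone 0 W" "open (gen_cone 0 W)"
proof -
  have b1: "w1 \<notin> set D" "is_basis (insert w1 (set D))" and b2: "w2 \<notin> set D"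
    using det_nz_basis[of w1] det_nz_basis[of w2] w1 w2 by auto
  show "open (gen_cone 0 W)"
    using open_gen_cone[OF fin _ b1(2)] D_subset w1(1) by auto
  define S where "S = (\<Sum>w\<in>W - set D. w \<bullet> c)"
  \<comment> \<open>\<open>S\<close> is the displacement of the plain sum from the hyperplane; extra
    weight \<open>r\<close> on one generator of the opposite side cancels it.\<close>
  obtain w' r where w': "w' \<in> W - set D" "0 \<le> r" "S + r * (w' \<bullet> c) = 0"
  proof (cases "0 \<le> S")
    case True
    thus ?thesis using that[of w2 "S / - (w2 \<bullet> c)"] b2 w2 by (simp add: divide_nonneg_neg)
  next
    case False
    thus ?thesis using that[of w1 "- S / (w1 \<bullet> c)"] b1 w1 by (simp add: divide_nonpos_pos)
  qed
  define s where "s = (\<lambda>w. 1 + (if w = w' then r else 0))"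
  define z where "z = (\<Sum>w\<in>W - set D. s w *\<^sub>R w)"
  have "z \<bullet> c = (\<Sum>w\<in>W - set D. w \<bullet> c + (if w = w' then r * (w \<bullet> c) else 0))"
    unfolding z_def inner_sum_left by (intro sum.cong) (auto simp: s_def distrib_right)
  also have "\<dots> = S + r * (w' \<bullet> c)" using w'(1) fin by (simp add: sum.distrib S_def)
  finally have zc: "z \<bullet> c = 0" using w'(3) by simp
  show "gen_cone 0 (set D) \<subseteq> gen_cone 0 W"
  proof
    fix q assume q: "q \<in> gen_cone 0 (set D)"
    have "eventually (\<lambda>\<epsilon>::real. 0 < \<epsilon>) (at_right 0)" by (simp add: eventually_at_right_less)
    hence "eventually (\<lambda>\<epsilon>. 0 < \<epsilon> \<and> (\<forall>u\<in>set D. 0 < representation (insert w1 (set D)) (q + \<epsilon> *\<^sub>R - z) u)) (at_right 0)"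
      using eventually_coordinates_pos[OF b1(2,1) q, of "- z"] by eventually_elim simp
    then obtain \<delta> where \<delta>: "0 < \<delta>" "\<forall>u\<in>set D. 0 < representation (insert w1 (set D)) (q + \<delta> *\<^sub>R - z) u"
      using eventually_happens'[OF trivial_limit_at_right_real] by blast
    let ?x = "q + \<delta> *\<^sub>R - z"
    have "q \<in> span (set D)" using gen_cone_in_span q by blast
    hence "?x \<bullet> c = 0" using zc inner_c_span[of q] by (simp add: inner_diff_left)
    hence "representation (insert w1 (set D)) ?x w1 = 0"
      using inner_c_representation[OF b1(2,1), of ?x] w1(2) by simp
    hence "?x = (\<Sum>u\<in>set D. representation (insert w1 (set D)) ?x u *\<^sub>R u)"
      using sum_representation_basis[OF b1(2), of ?x] b1(1) by simp
    hence "?x \<in> gen_cone 0 (set D)" unfolding gen_cone_0_iff using \<delta>(2) by blast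
    moreover have "\<delta> *\<^sub>R z \<in> gen_cone 0 (W - set D)"
      unfolding gen_cone_0_iff z_def using \<delta>(1) w'(2)
      by (intro exI[of _ "\<lambda>w. \<delta> * s w"]) (auto simp: s_def scaleR_right.sum)
    moreover have "q = \<delta> *\<^sub>R z + ?x" by simp
    ultimately show "q \<in> gen_cone 0 W" unfolding gen_cone_split[OF fin D_subset] by blast
  qed
qed

text \<open>Every point of the cone lies strictly on side \<open>s\<close> of the hyperplane that
  contains the cone over \<open>D\<close>, and \<open>q\<close> is a limit of points of the
  cone.\<close>

lemma diagonal_subset_frontier:
  assumes same: "\<forall>w\<in>W - set D. 0 < s * (w \<bullet> c)" and ne: "W - set D \<noteq> {}"
  shows "gen_cone 0 (set D) \<subseteq> frontier (gen_cone 0 W)" "x \<in> gen_cone 0 W \<Longrightarrow> 0 < s * (x \<bullet> c)"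
proof -
  show pos: "0 < s * (x \<bullet> c)" if "x \<in> gen_cone 0 W" for x
  proof -
    obtain t where t: "\<forall>w\<in>W. 0 < t w" "x = (\<Sum>w\<in>W. t w *\<^sub>R w)" using \<open>x \<in> gen_cone 0 W\<close> by (auto simp: gen_cone_0_iff)
    have "s * (x \<bullet> c) = (\<Sum>w\<in>W. t w * (s * (w \<bullet> c)))"
      by (simp add: t(2) inner_sum_left sum_distrib_left mult_ac)
    also have "\<dots> = (\<Sum>w\<in>W - set D. t w * (s * (w \<bullet> c)))"
      using fin inner_c_D by (intro sum.mono_neutral_right) auto
    also have "\<dots> > 0" using t(1) same ne fin by (intro sum_pos) auto
    finally show ?thesis .
  qed
  show "gen_cone 0 (set D) \<subseteq> frontier (gen_cone 0 W)"
  proof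
    fix q assume q: "q \<in> gen_cone 0 (set D)"
    have "q \<in> span (set D)" using gen_cone_in_span q by blast
    hence "q \<bullet> c = 0" by (rule inner_c_span)
    hence "q \<notin> gen_cone 0 W" using pos[of q] by auto
    hence "q \<notin> interior (gen_cone 0 W)" using interior_subset by blast
    moreover have "q \<in> closure (gen_cone 0 W)"
    proof (rule Lim_in_closed_set)
      show "((\<lambda>\<delta>. \<delta> *\<^sub>R (\<Sum>w\<in>W - set D. w) + q) \<longlongrightarrow> q) (at_right 0)"
        by (rule tendsto_eq_intros refl | simp)+
      have "eventually (\<lambda>\<delta>::real. 0 < \<delta>) (at_right 0)" by (simp add: eventually_at_right_less)
      thus "eventually (\<lambda>\<delta>. \<delta> *\<^sub>R (\<Sum>w\<in>W - set D. w) + q \<in> closure (gen_cone 0 W)) (at_right 0)"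
      proof eventually_elim
        case (elim \<delta>)
        have "\<delta> *\<^sub>R (\<Sum>w\<in>W - set D. w) + q \<in> gen_cone 0 W"
          unfolding gen_cone_split[OF fin D_subset] using gen_cone_scaled_sum[OF elim, of "W - set D"] q by blast
        thus ?case using closure_subset by blast
      qed
    qed auto
    ultimately show "q \<in> frontier (gen_cone 0 W)" by (simp add: frontier_def)
  qed
qed

text \<open>The closed spans other than that of \<open>D\<close> stay away from \<open>q\<close>;
  the span of \<open>D\<close> is left because \<open>x\<close> is transversal to it.\<close>

lemma eventually_generic:
  assumes nz: "\<forall>w\<in>W - set D. w \<bullet> c \<noteq> 0" and x: "x \<bullet> c \<noteq> 0"
    and q: "diagonal_generic q"
  shows "eventually (\<lambda>\<epsilon>. generic_point W (q + \<epsilon> *\<^sub>R x)) (at_right 0)"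
proof -
  have "eventually (\<lambda>\<epsilon>. \<forall>A\<in>{A. A \<subseteq> W \<and> card A < CARD('d)}. q + \<epsilon> *\<^sub>R x \<notin> span A) (at_right 0)"
  proof (intro eventually_ball_finite ballI)
    fix A assume A: "A \<in> {A. A \<subseteq> W \<and> card A < CARD('d)}"
    show "eventually (\<lambda>\<epsilon>. q + \<epsilon> *\<^sub>R x \<notin> span A) (at_right 0)"
    proof (cases "A = set D")
      case True
      have "q \<in> span (set D)" using gen_cone_in_span q unfolding diagonal_generic_def by blast
      hence "q \<bullet> c = 0" by (rule inner_c_span)
      have "eventually (\<lambda>\<epsilon>::real. 0 < \<epsilon>) (at_right 0)" by (simp add: eventually_at_right_less)
      thus ?thesis
      proof eventually_elim
        case (elim \<epsilon>)
        have "(q + \<epsilon> *\<^sub>R x) \<bullet> c \<noteq> 0" using elim x \<open>q \<bullet> c = 0\<close> by (simp add: inner_add_left)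
        thus ?case using inner_c_span True by blast
      qed
    next
      case False
      have "((\<lambda>\<epsilon>. q + \<epsilon> *\<^sub>R x) \<longlongrightarrow> q) (at_right 0)" by (rule tendsto_eq_intros refl | simp)+
      moreover have "open (- span A)" "q \<in> - span A" using q A False closed_span by (auto simp: open_Compl diagonal_generic_def)
      ultimately have "eventually (\<lambda>\<epsilon>. q + \<epsilon> *\<^sub>R x \<in> - span A) (at_right 0)" by (rule topological_tendstoD)
      thus ?thesis by simp
    qed
  qed (use fin in simp)
  thus ?thesis by eventually_elim (simp add: generic_point_def)
qed

text \<open>No coordinate of \<open>q\<close> vanishes, since otherwise \<open>q\<close> would lie
  in the span of a facet of \<sigma>, which is not \<open>D\<close>. The signs of the coordinates
  are therefore stable.\<close>

lemma eventually_mem_other_simplex: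
  assumes \<sigma>: "is_basis \<sigma>" "\<sigma> \<subseteq> W" "\<not> set D \<subseteq> \<sigma>"
    and q: "diagonal_generic q"
  shows "eventually (\<lambda>\<epsilon>. q + \<epsilon> *\<^sub>R x \<in> gen_cone 0 \<sigma> \<longleftrightarrow> q \<in> gen_cone 0 \<sigma>) (at_right 0)"
proof -
  note B = is_basisD[OF \<sigma>(1)]
  have nz: "representation \<sigma> q u \<noteq> 0" if u: "u \<in> \<sigma>" for u
  proof
    assume "representation \<sigma> q u = 0"
    hence "q = (\<Sum>w\<in>\<sigma> - {u}. representation \<sigma> q w *\<^sub>R w)"
      using sum_representation_basis[OF \<sigma>(1), of q] u B(1) by (simp add: sum.remove)
    moreover have "(\<Sum>w\<in>\<sigma> - {u}. representation \<sigma> q w *\<^sub>R w) \<in> span (\<sigma> - {u})"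
      by (intro span_sum span_scale span_base)
    ultimately have "q \<in> span (\<sigma> - {u})" by simp
    moreover have "card (\<sigma> - {u}) < CARD('d)" using u B by (metis card_Diff1_less)
    moreover have "\<sigma> - {u} \<subseteq> W" "\<sigma> - {u} \<noteq> set D" using \<sigma> by auto
    ultimately show False using q unfolding diagonal_generic_def by blast
  qed
  have "eventually (\<lambda>\<epsilon>. \<forall>u\<in>\<sigma>. (0 < representation \<sigma> (q + \<epsilon> *\<^sub>R x) u \<longleftrightarrow> 0 < representation \<sigma> q u)) (at_right 0)"
  proof (intro eventually_ball_finite ballI B(1))
    fix u assume "u \<in> \<sigma>"
    hence "0 < representation \<sigma> q u \<or> representation \<sigma> q u < 0" using nz by (simp add: neq_iff disj_commute)
    thus "eventually (\<lambda>\<epsilon>. 0 < representation \<sigma> (q + \<epsilon> *\<^sub>R x) u \<longleftrightarrow> 0 < representation \<sigma> q u) (at_right 0)"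
    proof
      assume p: "0 < representation \<sigma> q u"
      from order_tendstoD(1)[OF representation_tendsto[OF \<sigma>(1)] p, of x]
      show ?thesis by eventually_elim (use p in simp)
    next
      assume p: "representation \<sigma> q u < 0"
      from order_tendstoD(2)[OF representation_tendsto[OF \<sigma>(1)] p, of x]
      show ?thesis by eventually_elim (use p in simp)
    qed
  qed
  thus ?thesis by eventually_elim (auto simp: gen_cone_basis_iff[OF \<sigma>(1)])
qed

lemma jump_across_diagonal:
  assumes T: "triangulates T W" and nz: "\<forall>w\<in>W - set D. w \<bullet> c \<noteq> 0" and cc: "0 < c \<bullet> c"
    and q: "diagonal_generic q"
  shows "eventually (\<lambda>\<epsilon>. (\<Sum>w | w \<in> W - set D \<and> insert w (set D) \<in> T. sgn (w \<bullet> c))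
     = indicator (gen_cone 0 W) (q + \<epsilon> *\<^sub>R c) - indicator (gen_cone 0 W) (q + \<epsilon> *\<^sub>R - c)) (at_right 0)"
proof -
  note T = triangulatesD[OF T]
  have qD: "q \<in> gen_cone 0 (set D)" using q by (simp add: diagonal_generic_def)
  let ?A = "{w \<in> W - set D. insert w (set D) \<in> T}"
  let ?d = "\<lambda>S \<epsilon>. indicator S (q + \<epsilon> *\<^sub>R c) - indicator S (q + \<epsilon> *\<^sub>R - c) :: real"
  have "eventually (\<lambda>\<epsilon>. generic_point W (q + \<epsilon> *\<^sub>R c)) (at_right 0)"
    "eventually (\<lambda>\<epsilon>. generic_point W (q + \<epsilon> *\<^sub>R - c)) (at_right 0)"
    using cc by (intro eventually_generic[OF nz _ q]; simp)+
  moreover have "eventually (\<lambda>\<epsilon>. \<forall>\<sigma>\<in>T - (\<lambda>w. insert w (set D)) ` ?A. ?d (gen_cone 0 \<sigma>) \<epsilon> = 0) (at_right 0)"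
  proof (intro eventually_ball_finite ballI)
    fix \<sigma> assume \<sigma>: "\<sigma> \<in> T - (\<lambda>w. insert w (set D)) ` ?A"
    have *: "is_basis \<sigma>" "\<sigma> \<subseteq> W" using T(2) \<sigma> by auto
    have "\<not> set D \<subseteq> \<sigma>" using basis_containing_D[OF *] \<sigma> by blast
    from eventually_mem_other_simplex[OF * this q, of c] eventually_mem_other_simplex[OF * this q, of "- c"]
    show "eventually (\<lambda>\<epsilon>. ?d (gen_cone 0 \<sigma>) \<epsilon> = 0) (at_right 0)"
      by eventually_elim (simp add: indicator_def)
  qed (use T(1) in simp)
  moreover have "eventually (\<lambda>\<epsilon>. \<forall>w\<in>?A. ?d (gen_cone 0 (insert w (set D))) \<epsilon> = sgn (w \<bullet> c)) (at_right 0)"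
  proof (intro eventually_ball_finite ballI)
    fix w assume w: "w \<in> ?A"
    have *: "is_basis (insert w (set D))" "w \<notin> set D" using T(2) w by auto
    note L = linear_representation_basis[OF *(1), of w]
    \<comment> \<open>As \<open>c \<bullet> c\<close> is positive, the \<open>w\<close>-coordinate
      of \<open>c\<close> has the sign of \<open>w \<bullet> c\<close>: exactly one of the two
      shifted points is in this simplex, the one on the side of \<open>w\<close>.\<close>
    have rw: "c \<bullet> c = representation (insert w (set D)) c w * (w \<bullet> c)" by (rule inner_c_representation[OF *])
    have pos_iff: "(0 < representation (insert w (set D)) c w) = (0 < w \<bullet> c)"
      "(0 < representation (insert w (set D)) (- c) w) = (w \<bullet> c < 0)"
      using cc linear_neg[OF L, of c] unfolding rw by (auto simp: zero_less_mult_iff)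
    from eventually_mem_simplex_over_diagonal[OF * qD, of c] eventually_mem_simplex_over_diagonal[OF * qD, of "- c"]
    show "eventually (\<lambda>\<epsilon>. ?d (gen_cone 0 (insert w (set D))) \<epsilon> = sgn (w \<bullet> c)) (at_right 0)"
      by eventually_elim (use pos_iff in \<open>auto simp: indicator_def sgn_if\<close>)
  qed (use fin in simp)
  ultimately show ?thesis
  proof eventually_elim
    case (elim \<epsilon>)
    have "?d (gen_cone 0 W) \<epsilon> = (\<Sum>\<sigma>\<in>T. ?d (gen_cone 0 \<sigma>) \<epsilon>)"
      unfolding T(3)[OF elim(1)] T(3)[OF elim(2)] sum_subtractf ..
    also have "\<dots> = (\<Sum>\<sigma>\<in>(\<lambda>w. insert w (set D)) ` ?A. ?d (gen_cone 0 \<sigma>) \<epsilon>)"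
      using T(1) elim(3) by (intro sum.mono_neutral_right) auto
    also have "\<dots> = (\<Sum>w\<in>?A. ?d (gen_cone 0 (insert w (set D))) \<epsilon>)"
      by (rule sum.reindex_cong[of "\<lambda>w. insert w (set D)"]) (auto intro!: inj_onI)
    also have "\<dots> = (\<Sum>w\<in>?A. sgn (w \<bullet> c))" using elim(4) by (intro sum.cong) auto
    finally show ?case by simp
  qed
qed

section \<open>The value of the jump\<close>

lemma cone_poly_gen_cross:
  assumes T: "triangulates T W" and pos: "\<And>w. w \<in> W \<Longrightarrow> 0 < w \<bullet> \<xi>"
  shows "cone_poly v W c
     = (\<Sum>w | w \<in> W - set D \<and> insert w (set D) \<in> T. sgn (w \<bullet> c)) * (\<Prod>w\<in>W - set D. w \<bullet> c)"
proof -
  have "cone_poly v W = (\<lambda>\<xi>. \<Sum>\<sigma>\<in>T. abs_det_set \<sigma> * (\<Prod>w\<in>W - \<sigma>. w \<bullet> \<xi>))"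
    by (rule cone_poly_eq[OF fin pos T])
  thus ?thesis using sum_bases_eq[OF T pos] by simp
qed

text \<open>The point shifted to side \<open>s\<close> is in the cone, the other one is on the wrong
  side of the hyperplane.\<close>

lemma jump_same_sign:
  assumes T: "triangulates T W" and s: "s = 1 \<or> s = -1" and same: "\<forall>w\<in>W - set D. 0 < s * (w \<bullet> c)"
    and ne: "W - set D \<noteq> {}"
  shows "(\<Sum>w | w \<in> W - set D \<and> insert w (set D) \<in> T. sgn (w \<bullet> c)) = s"
proof -
  have nz: "\<forall>w\<in>W - set D. w \<bullet> c \<noteq> 0" using same by force
  \<comment> \<open>Any generator outside \<open>D\<close> will do: its simplex over
    \<open>D\<close> need not belong to \<open>T\<close>, it only has to lie in the cone.\<close>
  obtain w where w: "w \<in> W - set D" using ne by auto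
  note b = det_nz_basis[OF bspec[OF nz w]]
  have cc: "0 < c \<bullet> c" using c_neq_0[OF bspec[OF nz w]] .
  obtain q where q: "diagonal_generic q" using exists_diagonal_generic[OF nz b(3)] by blast
  hence qD: "q \<in> gen_cone 0 (set D)" by (simp add: diagonal_generic_def)
  have "q \<in> span (set D)" using gen_cone_in_span q unfolding diagonal_generic_def by blast
  hence qc: "q \<bullet> c = 0" by (rule inner_c_span)
  have "s *\<^sub>R c \<bullet> c = representation (insert w (set D)) (s *\<^sub>R c) w * (w \<bullet> c)"
    by (rule inner_c_representation[OF b(2,1)])
  hence "representation (insert w (set D)) (s *\<^sub>R c) w * (s * (w \<bullet> c)) = c \<bullet> c"
    using s by (elim disjE) simp_all
  hence "0 < representation (insert w (set D)) (s *\<^sub>R c) w"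
    using cc bspec[OF same w] zero_less_mult_pos2 by metis
  hence "eventually (\<lambda>\<epsilon>. q + \<epsilon> *\<^sub>R (s *\<^sub>R c) \<in> gen_cone 0 (insert w (set D))) (at_right 0)"
    using eventually_mem_simplex_over_diagonal[OF b(2,1) qD, of "s *\<^sub>R c"] by simp
  moreover have "eventually (\<lambda>\<epsilon>::real. 0 < \<epsilon>) (at_right 0)" by (simp add: eventually_at_right_less)
  ultimately have "eventually (\<lambda>\<epsilon>::real. (\<Sum>w | w \<in> W - set D \<and> insert w (set D) \<in> T. sgn (w \<bullet> c)) = s) (at_right 0)"
    using jump_across_diagonal[OF T nz cc q]
  proof eventually_elim
    case (elim \<epsilon>)
    have "insert w (set D) \<subseteq> W" using w D_subset by auto
    hence 1: "q + \<epsilon> *\<^sub>R (s *\<^sub>R c) \<in> gen_cone 0 W"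
      using gen_cone_basis_subset[OF fin _ b(2)] elim(1) by blast
    have "s * ((q + \<epsilon> *\<^sub>R - (s *\<^sub>R c)) \<bullet> c) < 0"
      using s elim(2) cc qc by (auto simp: inner_diff_left inner_add_left)
    hence "q + \<epsilon> *\<^sub>R - (s *\<^sub>R c) \<notin> gen_cone 0 W"
      using diagonal_subset_frontier(2)[OF same ne, of "q + \<epsilon> *\<^sub>R - (s *\<^sub>R c)"] by auto
    with 1 elim(3) s show ?case by auto
  qed
  thus ?thesis using eventually_happens'[OF trivial_limit_at_right_real] by blast
qed

text \<open>Here \<open>q\<close> is an interior point of the cone, so both shifted points lie
  inside and the jump is zero.\<close>

lemma jump_both_signs:
  assumes T: "triangulates T W" and nz: "\<forall>w\<in>W - set D. w \<bullet> c \<noteq> 0"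
    and w1: "w1 \<in> W" "0 < w1 \<bullet> c" and w2: "w2 \<in> W" "w2 \<bullet> c < 0"
  shows "(\<Sum>w | w \<in> W - set D \<and> insert w (set D) \<in> T. sgn (w \<bullet> c)) = 0"
proof -
  note K = diagonal_subset_cone[OF w1 w2]
  have cc: "0 < c \<bullet> c" and ind: "independent (set D)" using c_neq_0[of w1] det_nz_basis(3)[of w1] w1 by auto
  obtain q where q: "diagonal_generic q" using exists_diagonal_generic[OF nz ind] by blast
  hence qD: "q \<in> gen_cone 0 (set D)" by (simp add: diagonal_generic_def)
  have near: "eventually (\<lambda>\<epsilon>. q + \<epsilon> *\<^sub>R x \<in> gen_cone 0 W) (at_right 0)" for x
  proof -
    have "((\<lambda>\<epsilon>. q + \<epsilon> *\<^sub>R x) \<longlongrightarrow> q) (at_right 0)" by (rule tendsto_eq_intros refl | simp)+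
    thus ?thesis using K qD by (intro topological_tendstoD) auto
  qed
  have "eventually (\<lambda>\<epsilon>::real. (\<Sum>w | w \<in> W - set D \<and> insert w (set D) \<in> T. sgn (w \<bullet> c)) = 0) (at_right 0)"
    using near[of c] near[of "- c"] jump_across_diagonal[OF T nz cc q] by eventually_elim simp
  thus ?thesis using eventually_happens'[OF trivial_limit_at_right_real] by blast
qed

lemma extremal_iff: "extremal v W D \<longleftrightarrow> gen_cone 0 (set D) \<subseteq> frontier (gen_cone 0 W)"
proof -
  have "gen_cone v A = (+) v ` gen_cone 0 A" for A :: "(real ^ 'd::_) set"
    by (auto simp: gen_cone_def)
  thus ?thesis by (simp add: extremal_def frontier_translation inj_image_subset_iff)
qed

end

theorem mainTheorem1:
  fixes v :: "real ^ 'd::{finite,linorder}"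
    and W :: "(real ^ 'd::{finite,linorder}) set"
    and D :: "(real ^ 'd::{finite,linorder}) list"
  assumes "finite W" and "0 \<notin> W" and "card W \<ge> CARD('d)"
    and "strictly_convex_cone (gen_cone v W)"
    and "is_diagonal W D"
  shows "(extremal v W D \<longrightarrow>
           (\<exists>\<epsilon>\<in>{1, -1}.
              (\<forall>w\<in>W - set D. det_cols (D @ [w]) \<noteq> 0 \<longrightarrow> sgn (det_cols (D @ [w])) = \<epsilon>) \<and>
              cone_poly v W (gen_cross D) = \<epsilon> * (\<Prod>w\<in>W - set D. det_cols (D @ [w]))))
       \<and> (interior_diagonal v W D \<longrightarrow> cone_poly v W (gen_cross D) = 0)"
proof -
  interpret cone_diagonal W D using assms by unfold_locales
  obtain \<xi> where \<xi>: "\<And>w. w \<in> W \<Longrightarrow> 0 < w \<bullet> \<xi>"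
    using strictly_convex_cone_halfspace[OF assms(1,2,4)] by blast
  obtain T where T: "triangulates T W" using exists_triangulates[OF fin \<xi>] by blast
  have p: "cone_poly v W c
     = (\<Sum>w | w \<in> W - set D \<and> insert w (set D) \<in> T. sgn (w \<bullet> c)) * (\<Prod>w\<in>W - set D. w \<bullet> c)"
    by (rule cone_poly_gen_cross[OF T \<xi>])
  have ne: "W - set D \<noteq> {}"
  proof
    assume "W - set D = {}"
    hence "W = set D" using D_subset by auto
    thus False using card_D_less assms(3) by simp
  qed
  \<comment> \<open>Generators on both sides would place the cone over \<open>D\<close> inside the
    open cone, disjoint from its frontier.\<close>
  have one_side: False if "extremal v W D" "w1 \<in> W" "0 < w1 \<bullet> c" "w2 \<in> W" "w2 \<bullet> c < 0" for w1 w2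
  proof -
    note K = diagonal_subset_cone[OF that(2-)]
    have "gen_cone 0 (set D) \<inter> frontier (gen_cone 0 W) = {}"
      using K by (auto simp: frontier_def interior_open)
    \<comment> \<open>A witness that the cone over \<open>D\<close> is nonempty, so that
      disjointness contradicts inclusion.\<close>
    moreover have "1 *\<^sub>R (\<Sum>w\<in>set D. w) \<in> gen_cone 0 (set D)" by (rule gen_cone_scaled_sum) simp
    ultimately show False using that(1) unfolding extremal_iff by blast
  qed
  \<comment> \<open>The common sign of the nonzero determinants; the value -1 also serves when all
    of them vanish.\<close>
  define s :: real where "s = (if \<exists>w\<in>W - set D. 0 < w \<bullet> c then 1 else - 1)"
  have s: "s = 1 \<or> s = - 1" by (simp add: s_def)
  have signs: "sgn (w \<bullet> c) = s" if w: "extremal v W D" "w \<in> W - set D" "w \<bullet> c \<noteq> 0" for w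
  proof (cases "0 < w \<bullet> c")
    case True
    thus ?thesis using w(2) by (auto simp: s_def)
  next
    case False
    hence "w \<bullet> c < 0" using w(3) by simp
    moreover from this have "\<not> (\<exists>u\<in>W - set D. 0 < u \<bullet> c)" using one_side[OF w(1), of _ w] w(2) by blast
    ultimately show ?thesis by (simp add: s_def)
  qed
  have "cone_poly v W c = s * (\<Prod>w\<in>W - set D. w \<bullet> c)" if ext: "extremal v W D"
  proof (cases "\<exists>w\<in>W - set D. w \<bullet> c = 0")
    case True
    hence "(\<Prod>w\<in>W - set D. w \<bullet> c) = 0" using fin by (auto intro: prod_zero)
    thus ?thesis unfolding p by simp
  next
    case False
    have "\<forall>w\<in>W - set D. 0 < s * (w \<bullet> c)"
    proof
      fix w assume w: "w \<in> W - set D"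
      hence "w \<bullet> c \<noteq> 0" using False by blast
      with signs[OF ext w] show "0 < s * (w \<bullet> c)" by (auto simp: sgn_if split: if_splits)
    qed
    thus ?thesis unfolding p using jump_same_sign[OF T s _ ne] by simp
  qed
  moreover have "cone_poly v W c = 0" if int: "interior_diagonal v W D"
  proof (cases "\<exists>w\<in>W - set D. w \<bullet> c = 0")
    case True
    hence "(\<Prod>w\<in>W - set D. w \<bullet> c) = 0" using fin by (auto intro: prod_zero)
    thus ?thesis unfolding p by simp
  next
    case False
    \<comment> \<open>For \<open>r\<close> equal to 1 and -1 this excludes that all generators
      outside \<open>D\<close> lie on one side; as no determinant is zero, both signs occur.\<close>
    have "\<not> (\<forall>w\<in>W - set D. 0 < r * (w \<bullet> c))" for r
      using diagonal_subset_frontier(1)[OF _ ne, of r] int by (auto simp: interior_diagonal_def extremal_iff)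
    from this[of "- 1"] this[of 1] obtain w1 w2 where
      "w1 \<in> W" "0 < w1 \<bullet> c" "w2 \<in> W" "w2 \<bullet> c < 0"
      using False by (auto simp: not_less) (metis DiffI less_le)
    thus ?thesis unfolding p using jump_both_signs[OF T] False by simp
  qed
  ultimately show ?thesis
    using s signs unfolding inner_c[symmetric] by blast
qed

end
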